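(* Let $n\ge 1$ and let $(I,J)$ be a partial permutation of size $k$ in $\mathfrak{S}_n$ with cycle-path type $(\mu,\nu)$, and let $m=|I\cup J|$ (the number of distinct entries appearing in $I$ or $J$). Then there is a polynomial $f_{(\mu,\nu)}\in\mathbb{Z}[n,m_1,\dots,m_k]$, depending only on $(\mu,\nu)$, of degree $k$ with respect to the grading $\deg n=1$, $\deg m_i=i$, such that for every integer $n$ with $I\cup J\subseteq[n]$ and every partition $\lambda\vdash n$, $$(n)_m\cdot\mathbb{E}_\lambda[1_{IJ}]=f_{(\mu,\nu)}\big(n,m_1(\lambda),m_2(\lambda),\dots,m_k(\lambda)\big).$$
   Context: $[n]=\{1,\dots,n\}$, $\mathfrak{S}_n$ is the symmetric group on $[n]$. A partial permutation of size $k$ in $\mathfrak{S}_n$ is a pair $(I,J)$ of $k$-tuples $I=(i_1,\dots,i_k)$, $J=(j_1,\dots,j_k)$, each with distinct entries from $[n]$, encoding the bijection $i_\ell\mapsto j_\ell$ (pairs differing by a simultaneous reordering of $I$ and $J$ are identified). For $\pi\in\mathfrak{S}_n$, $1_{IJ}(\pi)=1$ if $\pi(i_\ell)=j_\ell$ for all $\ell\in[k]$ and $1_{IJ}(\pi)=0$ otherwise. The graph $G(I,J)$ has vertex set $I\cup J$ (the set of entries) and directed edges $i_\ell\to j_\ell$, $\ell\in[k]$; each connected component is a directed path or a directed cycle. The cycle partition $\mu$ is the partition whose parts are the lengths of the cycles, and the path partition $\nu$ is the partition whose parts are the lengths of the paths, where the length of a path $u_0\to u_1\to\dots\to u_\ell$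 is its number of edges $\ell$. The pair $(\mu,\nu)$ is the cycle-path type of $(I,J)$; note $|\mu|+|\nu|=k$. For $\lambda\vdash n$, $K_\lambda\subseteq\mathfrak{S}_n$ is the set of permutations of cycle type $\lambda$, $m_i(\lambda)$ is the number of parts of $\lambda$ equal to $i$, and $\mathbb{E}_\lambda[f]=\frac{1}{|K_\lambda|}\sum_{w\in K_\lambda}f(w)$. $(n)_m=n(n-1)\cdots(n-m+1)$ is the falling factorial. *)

theory Defs
  imports Complex_Main "HOL-Library.Multiset" "HOL-Library.Poly_Mapping"
    "HOL-Combinatorics.Permutations" "HOL-Combinatorics.Orbits"
begin

definition is_partition :: "nat multiset \<Rightarrow> nat \<Rightarrow> bool" where
  "is_partition lam n \<longleftrightarrow> 0 \<notin># lam \<and> sum_mset lam = n"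

definition cycle_type :: "nat \<Rightarrow> (nat \<Rightarrow> nat) \<Rightarrow> nat multiset" where
  "cycle_type n w = image_mset card (mset_set {orbit w x | x. x \<in> {1..n}})"

definition conj_class :: "nat \<Rightarrow> nat multiset \<Rightarrow> (nat \<Rightarrow> nat) set" where
  "conj_class n lam = {w. w permutes {1..n} \<and> cycle_type n w = lam}"

definition partial_perm :: "nat \<Rightarrow> nat list \<Rightarrow> nat list \<Rightarrow> bool" where
  "partial_perm n I J \<longleftrightarrow> length I = length J \<and> distinct I \<and> distinct J
     \<and> set I \<subseteq> {1..n} \<and> set J \<subseteq> {1..n}"

definition ind_IJ :: "nat list \<Rightarrow> nat list \<Rightarrow> (nat \<Rightarrow> nat) \<Rightarrow> bool" where
  "ind_IJ I J w \<longleftrightarrow> (\<forall>l < length I. w (I ! l) = J ! l)"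

definition expect_ind :: "nat \<Rightarrow> nat multiset \<Rightarrow> nat list \<Rightarrow> nat list \<Rightarrow> real" where
  "expect_ind n lam I J =
     real (card {w \<in> conj_class n lam. ind_IJ I J w}) / real (card (conj_class n lam))"

definition falling :: "nat \<Rightarrow> nat \<Rightarrow> real" where
  "falling n m = (\<Prod>i<m. real n - real i)"

definition adj :: "nat list \<Rightarrow> nat list \<Rightarrow> nat \<Rightarrow> nat \<Rightarrow> bool" where
  "adj I J x y \<longleftrightarrow> (\<exists>l < length I. (I ! l = x \<and> J ! l = y) \<or> (I ! l = y \<and> J ! l = x))"

definition component :: "nat list \<Rightarrow> nat list \<Rightarrow> nat \<Rightarrow> nat set" where
  "component I J x = {y. (adj I J)\<^sup>*\<^sup>* x y}"

definition components :: "nat list \<Rightarrow> nat list \<Rightarrow> nat set set" where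
  "components I J = component I J ` (set I \<union> set J)"

definition edges_in :: "nat list \<Rightarrow> nat list \<Rightarrow> nat set \<Rightarrow> nat" where
  "edges_in I J C = card {l. l < length I \<and> I ! l \<in> C}"

text \<open>A component (a directed path or cycle) is a cycle iff it has as many edges as vertices.\<close>
definition is_cycle_comp :: "nat list \<Rightarrow> nat list \<Rightarrow> nat set \<Rightarrow> bool" where
  "is_cycle_comp I J C \<longleftrightarrow> edges_in I J C = card C"

definition cycle_partition :: "nat list \<Rightarrow> nat list \<Rightarrow> nat multiset" where
  "cycle_partition I J = image_mset (edges_in I J)
     (mset_set {C \<in> components I J. is_cycle_comp I J C})"

definition path_partition :: "nat list \<Rightarrow> nat list \<Rightarrow> nat multiset" where
  "path_partition I J = image_mset (edges_in I J)
     (mset_set {C \<in> components I J. \<not> is_cycle_comp I J C})"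

section \<open>Integer polynomials in variables x_0 = n, x_i = m_i\<close>

text \<open>A polynomial in Z[x_0,x_1,...] is a finitely supported map from monomials
  (finitely supported exponent vectors) to integer coefficients.\<close>
type_synonym ipoly = "(nat \<Rightarrow>\<^sub>0 nat) \<Rightarrow>\<^sub>0 int"

definition ipoly_eval :: "ipoly \<Rightarrow> (nat \<Rightarrow> real) \<Rightarrow> real" where
  "ipoly_eval p x = sum (\<lambda>e. real_of_int (Poly_Mapping.lookup p e) *
      prod (\<lambda>i. x i ^ Poly_Mapping.lookup e i) (Poly_Mapping.keys e)) (Poly_Mapping.keys p)"

definition mono_wdeg :: "(nat \<Rightarrow>\<^sub>0 nat) \<Rightarrow> nat" where
  "mono_wdeg e = (\<Sum>i\<in>Poly_Mapping.keys e. max 1 i * Poly_Mapping.lookup e i)"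

definition ipoly_wdeg :: "ipoly \<Rightarrow> nat" where
  "ipoly_wdeg p = Max (mono_wdeg ` Poly_Mapping.keys p)"

definition ipoly_vars_le :: "ipoly \<Rightarrow> nat \<Rightarrow> bool" where
  "ipoly_vars_le p k \<longleftrightarrow> (\<forall>e\<in>Poly_Mapping.keys p. Poly_Mapping.keys e \<subseteq> {0..k})"

end

(* Conjugating by a random permutation turns (n)_m E[1_IJ] into the number of injections of the
   vertex set of G(I,J) that embed G(I,J) into the functional graph of one fixed permutation w of
   the given cycle type. That number N(mu, nu) depends only on the cycle-path type and satisfies a
   recursion: delete the last vertex of a path with l >= 1 edges. In an embedding of what remains,
   the image under w of the new end point is either a fresh point, or it must be the source of a
   path, since every other used point already has its w-preimage used. Hence
     N(mu, nu + l) = N(mu, nu + (l-1)) - N(mu + l, nu) - sum over l' in nu of N(mu, nu - l' + (l+l')),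
   where paths with 0 edges are isolated vertices and contribute factors n - const, and cycles alone
   give products of factors c m_c - const. The degree is attained because at n = 0, m_i = t^i all
   leading contributions carry the same sign (-1)^(number of paths). *)
theory Submission
  imports Defs "HOL-Combinatorics.Cycles"
begin

section \<open>Integer polynomials with weighted degree\<close>

text \<open>\<open>G(I,J)\<close> has no isolated vertices, but shortening a one-edge path creates
  one, so the recursion lives on a larger class of graphs; this is why paths are measured by
  vertices below. The difficulty is the exact degree: the recursion has minus signs, so top weights
  could cancel. Closing a path and merging two paths keep the number of edges and only shortening
  loses one, so the first term ought to have smaller weight. The exception is again the one-edge
  path, where the lost edge is replaced by a factor n - const, also of weight 1. The choice n = 0 on
  the test curve removes exactly this term. What survives comes from graphs with one path fewer and
  carries a minus sign. Coefficients stay integral because base points of cycles are counted rather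
  than cycles, so nothing is divided.\<close>

abbreviation monom_eval :: "(nat \<Rightarrow>\<^sub>0 nat) \<Rightarrow> (nat \<Rightarrow> real) \<Rightarrow> real" where
  "monom_eval e x \<equiv> \<Prod>i\<in>Poly_Mapping.keys e. x i ^ Poly_Mapping.lookup e i"

lemma monom_eval_superset:
  assumes "finite S" "Poly_Mapping.keys e \<subseteq> S"
  shows "monom_eval e x = (\<Prod>i\<in>S. x i ^ Poly_Mapping.lookup e i)"
  by (rule prod.mono_neutral_left) (use assms in \<open>auto simp: in_keys_iff\<close>)

lemma monom_eval_add: "monom_eval (e + e') x = monom_eval e x * monom_eval e' x"
proof -
  let ?S = "Poly_Mapping.keys e \<union> Poly_Mapping.keys e'"
  have "monom_eval (e + e') x = (\<Prod>i\<in>?S. x i ^ Poly_Mapping.lookup (e + e') i)"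
    by (rule monom_eval_superset) (auto simp: Poly_Mapping.keys_add)
  also have "\<dots> = (\<Prod>i\<in>?S. x i ^ Poly_Mapping.lookup e i) * (\<Prod>i\<in>?S. x i ^ Poly_Mapping.lookup e' i)"
    by (simp add: lookup_add power_add prod.distrib)
  also have "\<dots> = monom_eval e x * monom_eval e' x"
    by (simp add: monom_eval_superset[of ?S e] monom_eval_superset[of ?S e'])
  finally show ?thesis .
qed

lemma mono_wdeg_superset:
  assumes "finite S" "Poly_Mapping.keys e \<subseteq> S"
  shows "mono_wdeg e = (\<Sum>i\<in>S. max 1 i * Poly_Mapping.lookup e i)"
  unfolding mono_wdeg_def
  by (rule sum.mono_neutral_left) (use assms in \<open>auto simp: in_keys_iff\<close>)

lemma mono_wdeg_add: "mono_wdeg (e + e') = mono_wdeg e + mono_wdeg e'"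
proof -
  let ?S = "Poly_Mapping.keys e \<union> Poly_Mapping.keys e'"
  have "mono_wdeg (e + e') = (\<Sum>i\<in>?S. max 1 i * Poly_Mapping.lookup (e + e') i)"
    by (rule mono_wdeg_superset) (auto simp: Poly_Mapping.keys_add)
  also have "\<dots> = mono_wdeg e + mono_wdeg e'"
    by (simp add: mono_wdeg_superset[of ?S e] mono_wdeg_superset[of ?S e'] lookup_add
        add_mult_distrib2 sum.distrib)
  finally show ?thesis .
qed

section \<open>Evaluation as a ring homomorphism\<close>

lemma ipoly_eval_0 [simp]: "ipoly_eval 0 x = 0"
  by (simp add: ipoly_eval_def)

lemma ipoly_eval_single:
  "ipoly_eval (Poly_Mapping.single e c) x = of_int c * monom_eval e x"
  by (simp add: ipoly_eval_def)

lemma ipoly_eval_add: "ipoly_eval (p + q) x = ipoly_eval p x + ipoly_eval q x"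
  unfolding ipoly_eval_def
  by (rule setsum_keys_plus_distrib) (auto simp: algebra_simps)

lemma ipoly_eval_sum: "ipoly_eval (sum f A) x = (\<Sum>a\<in>A. ipoly_eval (f a) x)"
  by (induction A rule: infinite_finite_induct) (auto simp: ipoly_eval_add)

lemma ipoly_eval_sum_mset:
  "ipoly_eval (\<Sum>a\<in>#A. f a) x = (\<Sum>a\<in>#A. ipoly_eval (f a) x)"
  by (induction A) (auto simp: ipoly_eval_add)

lemma ipoly_eval_uminus: "ipoly_eval (- p) x = - ipoly_eval p x"
  by (simp add: ipoly_eval_def sum_negf)

lemma ipoly_eval_diff: "ipoly_eval (p - q) x = ipoly_eval p x - ipoly_eval q x"
  using ipoly_eval_add[of p "- q" x] by (simp add: ipoly_eval_uminus)

lemma ipoly_as_sum: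
  "(p :: ipoly) = (\<Sum>e\<in>Poly_Mapping.keys p. Poly_Mapping.single e (Poly_Mapping.lookup p e))"
proof (rule poly_mapping_eqI)
  fix e
  have "Poly_Mapping.lookup (\<Sum>e\<in>Poly_Mapping.keys p. Poly_Mapping.single e (Poly_Mapping.lookup p e)) e
      = (\<Sum>a\<in>Poly_Mapping.keys p. if a = e then Poly_Mapping.lookup p a else 0)"
    by (simp add: lookup_sum lookup_single when_def)
  also have "\<dots> = Poly_Mapping.lookup p e"
    by (auto simp: sum.delta in_keys_iff)
  finally show "Poly_Mapping.lookup p e = Poly_Mapping.lookup (\<Sum>e\<in>Poly_Mapping.keys p. Poly_Mapping.single e (Poly_Mapping.lookup p e)) e"
    by simp
qed

lemma ipoly_eval_mult: "ipoly_eval (p * q) x = ipoly_eval p x * ipoly_eval q x"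
proof -
  have "p * q = (\<Sum>a\<in>Poly_Mapping.keys p. Poly_Mapping.single a (Poly_Mapping.lookup p a)) *
      (\<Sum>b\<in>Poly_Mapping.keys q. Poly_Mapping.single b (Poly_Mapping.lookup q b))"
    by (simp flip: ipoly_as_sum)
  also have "\<dots> = (\<Sum>a\<in>Poly_Mapping.keys p. \<Sum>b\<in>Poly_Mapping.keys q.
     Poly_Mapping.single (a + b) (Poly_Mapping.lookup p a * Poly_Mapping.lookup q b))"
    by (simp only: sum_product mult_single)
  finally have "ipoly_eval (p * q) x = (\<Sum>a\<in>Poly_Mapping.keys p. \<Sum>b\<in>Poly_Mapping.keys q.
     of_int (Poly_Mapping.lookup p a * Poly_Mapping.lookup q b) * monom_eval (a + b) x)"
    by (simp only: ipoly_eval_sum ipoly_eval_single)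
  also have "\<dots> = ipoly_eval p x * ipoly_eval q x"
    by (simp add: monom_eval_add ipoly_eval_def sum_product mult_ac)
  finally show ?thesis .
qed

text \<open>A bound instead of \<open>ipoly_wdeg\<close>: it also makes sense for the zero
  polynomial, whose \<open>Max\<close> is taken over the empty set, and it survives cancellation in
  sums.\<close>

definition ipoly_bounded :: "ipoly \<Rightarrow> nat \<Rightarrow> nat \<Rightarrow> bool" where
  "ipoly_bounded p v D \<longleftrightarrow>
     ipoly_vars_le p v \<and> (\<forall>e\<in>Poly_Mapping.keys p. mono_wdeg e \<le> D)"

section \<open>Stability of the upper bounds under ring operations\<close>

lemma ipoly_bounded_mono:
  "ipoly_bounded p v D \<Longrightarrow> v \<le> v' \<Longrightarrow> D \<le> D' \<Longrightarrow> ipoly_bounded p v' D'"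
  unfolding ipoly_bounded_def ipoly_vars_le_def by force

lemma ipoly_bounded_0 [simp]: "ipoly_bounded 0 v D"
  by (simp add: ipoly_bounded_def ipoly_vars_le_def)

lemma ipoly_bounded_add:
  "ipoly_bounded p v D \<Longrightarrow> ipoly_bounded q v D \<Longrightarrow> ipoly_bounded (p + q) v D"
  using Poly_Mapping.keys_add[of p q] unfolding ipoly_bounded_def ipoly_vars_le_def by blast

lemma ipoly_bounded_uminus: "ipoly_bounded p v D \<Longrightarrow> ipoly_bounded (- p) v D"
  by (simp add: ipoly_bounded_def ipoly_vars_le_def)

lemma ipoly_bounded_diff:
  "ipoly_bounded p v D \<Longrightarrow> ipoly_bounded q v D \<Longrightarrow> ipoly_bounded (p - q) v D"
  using ipoly_bounded_add[of p v D "- q"] by (simp add: ipoly_bounded_uminus)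

lemma ipoly_bounded_sum_mset:
  "(\<And>a. a \<in># A \<Longrightarrow> ipoly_bounded (f a) v D) \<Longrightarrow> ipoly_bounded (\<Sum>a\<in>#A. f a) v D"
  by (induction A) (auto simp: ipoly_bounded_add)

lemma ipoly_bounded_mult:
  assumes "ipoly_bounded p v D" "ipoly_bounded q v D'"
  shows "ipoly_bounded (p * q) v (D + D')"
proof -
  have "Poly_Mapping.keys e \<subseteq> {0..v} \<and> mono_wdeg e \<le> D + D'" if e_in: "e \<in> Poly_Mapping.keys (p * q)" for e
  proof -
    obtain a b where e: "e = a + b" and ab: "a \<in> Poly_Mapping.keys p" "b \<in> Poly_Mapping.keys q"
      using e_in keys_mult[of p q] by blast
    have "Poly_Mapping.keys e \<subseteq> Poly_Mapping.keys a \<union> Poly_Mapping.keys b"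
      using Poly_Mapping.keys_add[of a b] e by simp
    moreover have "Poly_Mapping.keys a \<subseteq> {0..v}" "Poly_Mapping.keys b \<subseteq> {0..v}"
      using assms ab by (auto simp: ipoly_bounded_def ipoly_vars_le_def)
    ultimately have "Poly_Mapping.keys e \<subseteq> {0..v}" by blast
    moreover have "mono_wdeg e \<le> D + D'"
      using assms ab by (simp add: e mono_wdeg_add ipoly_bounded_def add_mono)
    ultimately show ?thesis by blast
  qed
  then show ?thesis by (auto simp: ipoly_bounded_def ipoly_vars_le_def)
qed

lemma ipoly_bounded_of_int [simp]: "ipoly_bounded (of_int c) v D"
  by (simp add: ipoly_bounded_def ipoly_vars_le_def mono_wdeg_def flip: single_of_int)

lemma ipoly_eval_of_int [simp]: "ipoly_eval (of_int c) x = of_int c"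
  by (simp add: ipoly_eval_single flip: single_of_int)

lemma ipoly_eval_of_nat [simp]: "ipoly_eval (of_nat c) x = of_nat c"
  using ipoly_eval_of_int[of "int c"] by simp

definition ipoly_var :: "nat \<Rightarrow> ipoly" where
  "ipoly_var i = Poly_Mapping.single (Poly_Mapping.single i 1) 1"

lemma ipoly_eval_var [simp]: "ipoly_eval (ipoly_var i) x = x i"
  by (simp add: ipoly_var_def ipoly_eval_single)

lemma ipoly_bounded_var: "i \<le> v \<Longrightarrow> max 1 i \<le> D \<Longrightarrow> ipoly_bounded (ipoly_var i) v D"
  by (simp add: ipoly_var_def ipoly_bounded_def ipoly_vars_le_def mono_wdeg_def)

text \<open>Along the curve \<open>n = 0\<close>, \<open>m_i = t^i\<close> a monomial of weight \<open>D\<close> that does not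
  involve \<open>n\<close> grows like \<open>t^D\<close>, so a nonzero limit of \<open>p / t^D\<close> certifies degree at least \<open>D\<close>.\<close>
definition weight_curve :: "real \<Rightarrow> nat \<Rightarrow> real" where
  "weight_curve t i = (if i = 0 then 0 else t ^ i)"

text \<open>For a polynomial of weight at most D, L is the sum of the coefficients of its weight-D
  monomials without n. As a limit, it is additive and multiplicative by the rules for
  \<open>tendsto\<close>.\<close>

definition leading_limit :: "ipoly \<Rightarrow> nat \<Rightarrow> real \<Rightarrow> bool" where
  "leading_limit p D L \<longleftrightarrow> ((\<lambda>t. ipoly_eval p (weight_curve t) / t ^ D) \<longlongrightarrow> L) at_top"

section \<open>Arithmetic of leading limits\<close>

lemma leading_limit_diff:
  "leading_limit p D L \<Longrightarrow> leading_limit q D M \<Longrightarrow> leading_limit (p - q) D (L - M)"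
  unfolding leading_limit_def ipoly_eval_diff diff_divide_distrib by (rule tendsto_diff)

lemma leading_limit_add:
  "leading_limit p D L \<Longrightarrow> leading_limit q D M \<Longrightarrow> leading_limit (p + q) D (L + M)"
  unfolding leading_limit_def ipoly_eval_add add_divide_distrib by (rule tendsto_add)

lemma leading_limit_0 [simp]: "leading_limit 0 D 0"
  by (simp add: leading_limit_def)

lemma leading_limit_sum_mset:
  "(\<And>a. a \<in># A \<Longrightarrow> leading_limit (f a) D (L a)) \<Longrightarrow> leading_limit (\<Sum>a\<in>#A. f a) D (\<Sum>a\<in>#A. L a)"
  by (induction A) (auto simp: leading_limit_add)

lemma leading_limit_mult:
  assumes "leading_limit p D L" "leading_limit q D' M"
  shows "leading_limit (p * q) (D + D') (L * M)"
  using tendsto_mult[OF assms[unfolded leading_limit_def]]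
  by (simp add: leading_limit_def ipoly_eval_mult power_add)

lemma tendsto_inverse_power_at_top:
  "0 < k \<Longrightarrow> ((\<lambda>t::real. inverse (t ^ k)) \<longlongrightarrow> 0) at_top"
  by (rule tendsto_inverse_0_at_top) (rule filterlim_pow_at_top[OF _ filterlim_ident])

lemma leading_limit_of_int: "0 < D \<Longrightarrow> leading_limit (of_int c) D 0"
  using tendsto_mult[OF tendsto_const[of "of_int c :: real"] tendsto_inverse_power_at_top, of D]
  by (simp add: leading_limit_def divide_inverse)

lemma leading_limit_of_int_0: "leading_limit (of_int c) 0 (of_int c)"
  by (simp add: leading_limit_def)

lemma leading_limit_var: "0 < i \<Longrightarrow> leading_limit (ipoly_var i) i 1"
  unfolding leading_limit_def
  by (rule tendsto_eventually, rule eventually_mono[OF eventually_gt_at_top[of 0]])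
     (simp add: weight_curve_def)

text \<open>Holds even for D at most 1, because n is identically 0 on the curve.\<close>

lemma leading_limit_var_0: "leading_limit (ipoly_var 0) D 0"
  by (simp add: leading_limit_def weight_curve_def)

text \<open>The two sides are equal unless n occurs in the monomial; then the left side is
  0.\<close>

lemma monom_eval_weight_curve:
  "\<bar>monom_eval e (weight_curve t)\<bar> \<le> \<bar>t\<bar> ^ mono_wdeg e"
proof (cases "0 \<in> Poly_Mapping.keys e")
  case True
  then have "monom_eval e (weight_curve t) = 0"
    by (intro prod_zero) (auto simp: weight_curve_def in_keys_iff intro!: bexI[of _ 0])
  then show ?thesis by (metis abs_zero zero_le_power abs_ge_zero)
next
  case False
  have "\<bar>monom_eval e (weight_curve t)\<bar> = (\<Prod>i\<in>Poly_Mapping.keys e. \<bar>t\<bar> ^ (max 1 i * Poly_Mapping.lookup e i))"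
    unfolding abs_prod
  proof (rule prod.cong)
    fix i assume "i \<in> Poly_Mapping.keys e"
    with False have "i > 0" by (metis gr0I)
    then show "\<bar>weight_curve t i ^ Poly_Mapping.lookup e i\<bar> = \<bar>t\<bar> ^ (max 1 i * Poly_Mapping.lookup e i)"
      by (simp add: weight_curve_def power_abs power_mult max_def)
  qed simp
  then show ?thesis by (simp add: mono_wdeg_def power_sum)
qed

lemma leading_limit_0_if_smaller_weights:
  assumes "\<And>e. e \<in> Poly_Mapping.keys p \<Longrightarrow> mono_wdeg e < D"
  shows "leading_limit p D 0"
proof -
  have "((\<lambda>t. of_int (Poly_Mapping.lookup p e) * (monom_eval e (weight_curve t) / t ^ D)) \<longlongrightarrow> of_int (Poly_Mapping.lookup p e) * 0) at_top"
    if "e \<in> Poly_Mapping.keys p" for e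
  proof (intro tendsto_mult tendsto_const)
    have lt: "mono_wdeg e < D" using assms that .
    have "\<forall>\<^sub>F t in at_top. norm (monom_eval e (weight_curve t) / t ^ D) \<le> norm (inverse (t ^ (D - mono_wdeg e))) * 1"
    proof (rule eventually_mono[OF eventually_gt_at_top[of 0]])
      fix t :: real assume t: "0 < t"
      have "norm (monom_eval e (weight_curve t) / t ^ D) \<le> \<bar>t\<bar> ^ mono_wdeg e / t ^ D"
        using t monom_eval_weight_curve[of t e] by (simp add: divide_right_mono del: abs_prod)
      also have "\<dots> = norm (inverse (t ^ (D - mono_wdeg e))) * 1"
        using t lt by (simp add: power_diff field_simps)
      finally show "norm (monom_eval e (weight_curve t) / t ^ D) \<le> norm (inverse (t ^ (D - mono_wdeg e))) * 1" .
    qed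
    then show "((\<lambda>t. monom_eval e (weight_curve t) / t ^ D) \<longlongrightarrow> 0) at_top"
      by (rule tendsto_0_le[OF tendsto_inverse_power_at_top, rotated]) (use lt in simp)
  qed
  from tendsto_sum[OF this] show ?thesis
    by (simp add: leading_limit_def ipoly_eval_def sum_divide_distrib)
qed

lemma leading_limit_0_if_bounded: "ipoly_bounded p v D' \<Longrightarrow> D' < D \<Longrightarrow> leading_limit p D 0"
  by (rule leading_limit_0_if_smaller_weights) (auto simp: ipoly_bounded_def)

text \<open>For the lower bound: if all monomials had weight below D, the limit would be 0,
  contradicting uniqueness of limits.\<close>

lemma ipoly_wdeg_eqI:
  assumes "ipoly_bounded p v D" "leading_limit p D L" "L \<noteq> 0"
  shows "p \<noteq> 0" "ipoly_wdeg p = D"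
proof -
  have uniq: "\<not> leading_limit p D 0"
    using assms(2,3) tendsto_unique[OF trivial_limit_at_top_linorder] unfolding leading_limit_def by blast
  then show "p \<noteq> 0" by (metis leading_limit_0)
  have "\<exists>e\<in>Poly_Mapping.keys p. D \<le> mono_wdeg e"
    using uniq leading_limit_0_if_smaller_weights[of p D] by (meson not_le)
  moreover have "\<forall>e\<in>Poly_Mapping.keys p. mono_wdeg e \<le> D"
    using assms(1) by (simp add: ipoly_bounded_def)
  ultimately show "ipoly_wdeg p = D"
    unfolding ipoly_wdeg_def by (intro Max_eqI) (auto intro: image_eqI le_antisym)
qed

section \<open>Placements of cycles and paths in the graph of a permutation\<close>

text \<open>Being a set, it has fewer than d elements as soon as the walk repeats a point; thus
  \<open>card (segment w x d) = d\<close> expresses injectivity of the walk.\<close>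

definition segment :: "('a \<Rightarrow> 'a) \<Rightarrow> 'a \<Rightarrow> nat \<Rightarrow> 'a set" where
  "segment w x d = (\<lambda>j. (w ^^ j) x) ` {..<d}"

section \<open>Segments, orbits and sharp union bounds\<close>

lemma finite_segment [simp]: "finite (segment w x d)"
  by (simp add: segment_def)

lemma card_segment_le: "card (segment w x d) \<le> d"
  unfolding segment_def using card_image_le[of "{..<d}"] by simp

lemma segment_0 [simp]: "segment w x 0 = {}"
  by (simp add: segment_def)

lemma segment_Suc: "segment w x (Suc l) = insert ((w ^^ l) x) (segment w x l)"
  by (simp add: segment_def lessThan_Suc)

lemma segment_add: "segment w x (l + d) = segment w x l \<union> segment w ((w ^^ l) x) d"
proof (induction d)
  case (Suc d)
  have "(w ^^ (l + d)) x = (w ^^ d) ((w ^^ l) x)"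
    by (simp add: funpow_add add.commute[of l])
  with Suc show ?case by (simp add: segment_Suc)
qed simp

lemma start_in_segment: "0 < d \<Longrightarrow> x \<in> segment w x d"
  unfolding segment_def by (rule image_eqI[of _ _ 0]) auto

lemma funpow_in_segment: "j < d \<Longrightarrow> (w ^^ j) x \<in> segment w x d"
  by (auto simp: segment_def)

lemma card_segment_eq_iff: "card (segment w x d) = d \<longleftrightarrow> inj_on (\<lambda>j. (w ^^ j) x) {..<d}"
  unfolding segment_def by (subst inj_on_iff_eq_card) auto

lemma segment_subset: "w permutes X \<Longrightarrow> x \<in> X \<Longrightarrow> segment w x d \<subseteq> X"
  unfolding segment_def by (auto simp: permutes_in_image[OF permutes_funpow])

text \<open>Returning after d steps only makes the orbit length a divisor of d; d distinct points
  along the way exclude the proper divisors.\<close>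

lemma card_orbit_eq_iff:
  assumes "x \<in> orbit w x" "0 < d"
  shows "card (orbit w x) = d \<longleftrightarrow> (w ^^ d) x = x \<and> card (segment w x d) = d"
proof
  assume "(w ^^ d) x = x \<and> card (segment w x d) = d"
  then show "card (orbit w x) = d"
    using orbit_altdef_bounded[of d w x] assms by (auto simp: segment_def image_def Bex_def conj_commute)
next
  assume card: "card (orbit w x) = d"
  define c where "c = funpow_dist1 w x x"
  have orb: "orbit w x = segment w x c"
    unfolding segment_def c_def using orbit_conv_funpow_dist1[OF assms(1)] by (simp add: atLeast0LessThan)
  have "inj_on (\<lambda>j. (w ^^ j) x) {..<c}"
    unfolding c_def using inj_on_funpow_dist1[OF assms(1)] by (simp add: atLeast0LessThan)
  then have "c = d"
    using card orb card_segment_eq_iff by metis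
  moreover have "(w ^^ c) x = x"
    unfolding c_def using funpow_dist1_prop[OF assms(1)] .
  ultimately show "(w ^^ d) x = x \<and> card (segment w x d) = d"
    using card orb by simp
qed

lemma orbit_eq_segment: "(w ^^ d) x = x \<Longrightarrow> 0 < d \<Longrightarrow> orbit w x = segment w x d"
  using orbit_altdef_bounded[of d w x] by (auto simp: segment_def)

text \<open>The union bound is sharp exactly when all sets have maximal size and are pairwise
  disjoint. This form peels off one index, so that one added cycle or path can be analysed against
  the rest.\<close>

lemma card_UN_eq_sum_insert_iff:
  assumes "finite K" "a \<notin> K" "\<And>k. finite (S k)" "\<And>k. card (S k) \<le> d k"
  shows "card (\<Union>k\<in>insert a K. S k) = (\<Sum>k\<in>insert a K. d k) \<longleftrightarrow>
    card (\<Union>k\<in>K. S k) = (\<Sum>k\<in>K. d k) \<and> card (S a) = d a \<and> S a \<inter> (\<Union>k\<in>K. S k) = {}"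
proof -
  let ?U = "\<Union>k\<in>K. S k"
  have "card ?U \<le> (\<Sum>k\<in>K. card (S k))" using assms(1) by (rule card_UN_le)
  also have "\<dots> \<le> (\<Sum>k\<in>K. d k)" using assms(4) by (rule sum_mono)
  finally have le: "card ?U \<le> (\<Sum>k\<in>K. d k)" .
  have fin: "finite ?U" using assms by auto
  have "card (S a) + card ?U = card (S a \<union> ?U) + card (S a \<inter> ?U)"
    using assms(3) fin by (rule card_Un_Int)
  moreover have "card (S a \<inter> ?U) = 0 \<longleftrightarrow> S a \<inter> ?U = {}"
    using fin by (subst card_0_eq) auto
  moreover have "(\<Sum>k\<in>insert a K. d k) = d a + (\<Sum>k\<in>K. d k)"
    using assms by simp
  moreover have "(\<Union>k\<in>insert a K. S k) = S a \<union> ?U" by auto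
  ultimately show ?thesis using le assms(4)[of a] by auto
qed

lemma card_UN_eq_sumD:
  assumes "card (\<Union>k\<in>K. S k) = (\<Sum>k\<in>K. d k)" "finite K" "\<And>k. finite (S k)" "\<And>k. card (S k) \<le> d k"
    and "a \<in> K"
  shows "card (S a) = d a" "\<And>b. b \<in> K \<Longrightarrow> a \<noteq> b \<Longrightarrow> S a \<inter> S b = {}"
proof -
  have K: "insert a (K - {a}) = K" using assms by auto
  have "card (\<Union>k\<in>K-{a}. S k) = (\<Sum>k\<in>K-{a}. d k) \<and> card (S a) = d a \<and> S a \<inter> (\<Union>k\<in>K-{a}. S k) = {}"
    using card_UN_eq_sum_insert_iff[of "K - {a}" a S d] assms K by simp
  then show "card (S a) = d a" "\<And>b. b \<in> K \<Longrightarrow> a \<noteq> b \<Longrightarrow> S a \<inter> S b = {}" by blast+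
qed

text \<open>Counts extensions by one index: the set of admissible values may depend on the partial
  choice as long as its size does not.\<close>

lemma card_PiE_insert_fibres:
  assumes "a \<notin> K" "T0 \<subseteq> K \<rightarrow>\<^sub>E X" "finite T0" "finite X"
    and Q: "\<And>s. s \<in> T0 \<Longrightarrow> Q s \<subseteq> X" "\<And>s. s \<in> T0 \<Longrightarrow> card (Q s) = q"
    and T: "T = {s \<in> insert a K \<rightarrow>\<^sub>E X. restrict s K \<in> T0 \<and> s a \<in> Q (restrict s K)}"
  shows "card T = card T0 * q"
proof -
  have upd: "restrict (s(a := x)) K = s" if "s \<in> T0" for s x
    using that assms(1,2) by (auto simp: fun_eq_iff PiE_def extensional_def restrict_def)
  have "bij_betw (\<lambda>(s, x). s(a := x)) (Sigma T0 Q) T"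
  proof (rule bij_betw_byWitness[where f' = "\<lambda>s. (restrict s K, s a)"])
    show "\<forall>p\<in>Sigma T0 Q. (\<lambda>s. (restrict s K, s a)) ((\<lambda>(s, x). s(a := x)) p) = p"
      using upd by auto
    show "\<forall>s\<in>T. (\<lambda>(s, x). s(a := x)) (restrict s K, s a) = s"
      unfolding T by (auto simp: fun_eq_iff PiE_def extensional_def)
    show "(\<lambda>(s, x). s(a := x)) ` Sigma T0 Q \<subseteq> T"
    proof clarsimp
      fix s x assume s: "s \<in> T0" "x \<in> Q s"
      then have "s \<in> K \<rightarrow>\<^sub>E X" "x \<in> X" using assms(2) Q by auto
      then have "s(a := x) \<in> insert a K \<rightarrow>\<^sub>E X" by (rule PiE_fun_upd[rotated])
      then show "s(a := x) \<in> T" using s upd unfolding T by simp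
    qed
    show "(\<lambda>s. (restrict s K, s a)) ` T \<subseteq> Sigma T0 Q"
      unfolding T by auto
  qed
  then have "card T = card (Sigma T0 Q)" by (simp add: bij_betw_same_card)
  also have "\<dots> = (\<Sum>s\<in>T0. card (Q s))"
    using assms(3,4) Q by (intro card_SigmaI) (auto intro: finite_subset)
  also have "\<dots> = card T0 * q" using Q by simp
  finally show ?thesis .
qed

text \<open>An injective copy inside the functional graph of \<open>w\<close> of a disjoint union of directed
  cycles (indexed by \<open>A\<close>) and directed paths (indexed by \<open>B\<close>) with \<open>d k\<close> vertices each is
  recorded by the image \<open>s k\<close> of one chosen vertex per cycle and of the source of each path.
  Injectivity is the statement that the segments cover as many points as there are vertices.\<close>
definition placements ::
  "'a set \<Rightarrow> ('a \<Rightarrow> 'a) \<Rightarrow> 'i set \<Rightarrow> 'i set \<Rightarrow> ('i \<Rightarrow> nat) \<Rightarrow> ('i \<Rightarrow> 'a) set" where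
  "placements X w A B d = {s \<in> (A \<union> B) \<rightarrow>\<^sub>E X. (\<forall>k\<in>A. (w ^^ d k) (s k) = s k) \<and>
     card (\<Union>k\<in>A \<union> B. segment w (s k) (d k)) = (\<Sum>k\<in>A \<union> B. d k)}"

section \<open>Counting placements one component at a time\<close>

lemma placements_cong:
  "(\<And>k. k \<in> A \<union> B \<Longrightarrow> d k = d' k) \<Longrightarrow> placements X w A B d = placements X w A B d'"
  unfolding placements_def by (intro Collect_cong conj_cong) (auto intro!: arg_cong[of _ _ card])

lemma finite_placements: "finite X \<Longrightarrow> finite A \<Longrightarrow> finite B \<Longrightarrow> finite (placements X w A B d)"
  unfolding placements_def by (rule finite_subset[of _ "(A \<union> B) \<rightarrow>\<^sub>E X"]) (auto intro!: finite_PiE)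

lemma placementsD:
  assumes "s \<in> placements X w A B d" "finite A" "finite B"
  shows "\<And>k. k \<in> A \<union> B \<Longrightarrow> s k \<in> X"
    and "\<And>k. k \<in> A \<Longrightarrow> (w ^^ d k) (s k) = s k"
    and "\<And>k. k \<in> A \<union> B \<Longrightarrow> card (segment w (s k) (d k)) = d k"
    and "\<And>k k'. k \<in> A \<union> B \<Longrightarrow> k' \<in> A \<union> B \<Longrightarrow> k \<noteq> k' \<Longrightarrow>
          segment w (s k) (d k) \<inter> segment w (s k') (d k') = {}"
  using assms card_UN_eq_sumD[of "\<lambda>k. segment w (s k) (d k)" "A \<union> B" d]
  by (auto simp: placements_def card_segment_le PiE_iff)

lemma placements_empty: "placements X w {} {} d = {\<lambda>_. undefined}"
  by (auto simp: placements_def)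

text \<open>The segment of a one-vertex path is a single point, which may lie anywhere outside the
  cover; the sharp cardinality condition fixes the size of the cover.\<close>

lemma card_placements_isolated:
  assumes "w permutes X" "finite X" "finite A" "finite B" "b \<notin> A" "b \<notin> B" "d b = 1"
  shows "real (card (placements X w A (insert b B) d)) =
    real (card (placements X w A B d)) * (real (card X) - real (\<Sum>k\<in>A \<union> B. d k))"
proof -
  let ?U = "\<lambda>s. \<Union>k\<in>A \<union> B. segment w (s k) (d k)"
  let ?q = "card X - (\<Sum>k\<in>A \<union> B. d k)"
  have sub: "?U s \<subseteq> X" and card: "card (?U s) = (\<Sum>k\<in>A \<union> B. d k)" if "s \<in> placements X w A B d" for s
    using that segment_subset[OF assms(1)] by (auto simp: placements_def PiE_iff dest!: subsetD)
  have "card (placements X w A (insert b B) d) = card (placements X w A B d) * ?q"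
  proof (rule card_PiE_insert_fibres)
    show "placements X w A (insert b B) d = {s \<in> insert b (A \<union> B) \<rightarrow>\<^sub>E X.
      restrict s (A \<union> B) \<in> placements X w A B d \<and> s b \<in> X - ?U (restrict s (A \<union> B))}"
    proof (intro set_eqI, goal_cases)
      case (1 s)
      have U: "?U (restrict s (A \<union> B)) = ?U s" by auto
      have "card (\<Union>k\<in>insert b (A \<union> B). segment w (s k) (d k)) = (\<Sum>k\<in>insert b (A \<union> B). d k) \<longleftrightarrow>
        card (?U s) = (\<Sum>k\<in>A \<union> B. d k) \<and> s b \<notin> ?U s"
        using assms by (subst card_UN_eq_sum_insert_iff)
          (auto simp: card_segment_le segment_Suc[of _ _ 0, simplified])
      then show ?case unfolding placements_def U mem_Collect_eq
        using U by (auto simp: PiE_iff)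
    qed
    show "card (X - ?U s) = ?q" if "s \<in> placements X w A B d" for s
      using sub[OF that] card[OF that] assms by (simp add: card_Diff_subset)
  qed (use assms in \<open>auto simp: finite_placements, auto simp: placements_def\<close>)
  \<comment> \<open>The fibre size is a truncated difference. It agrees with the real one as soon as
    a placement exists; otherwise both sides vanish, even if the real factor is negative.\<close>
  moreover have "(\<Sum>k\<in>A \<union> B. d k) \<le> card X" if "placements X w A B d \<noteq> {}"
  proof -
    from that obtain s where "s \<in> placements X w A B d" by blast
    with sub card have "?U s \<subseteq> X" "card (?U s) = (\<Sum>k\<in>A \<union> B. d k)" by blast+
    then show ?thesis using card_mono[OF assms(2)] by metis
  qed
  ultimately show ?thesis
    by (cases "placements X w A B d = {}") (auto simp: of_nat_diff)
qed

text \<open>A closed segment is a full orbit of \<open>w\<close>. Hence the placed cycles of length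
  \<open>d a\<close> use up whole orbits of that size, those of other lengths avoid them, and the
  number of free base points is the same for every placement.\<close>

lemma card_placements_insert_cycle:
  assumes w: "w permutes X" "finite X" and "finite A" "a \<notin> A" "0 < d a" "\<And>k. k \<in> A \<Longrightarrow> 0 < d k"
  shows "real (card (placements X w (insert a A) {} d)) = real (card (placements X w A {} d)) *
    (real (card {x \<in> X. card (orbit w x) = d a}) - real (d a) * real (card {k \<in> A. d k = d a}))"
proof -
  let ?U = "\<lambda>s. \<Union>k\<in>A. segment w (s k) (d k)"
  let ?C = "{x \<in> X. card (orbit w x) = d a}"
  let ?q = "card ?C - d a * card {k \<in> A. d k = d a}"
  have self: "x \<in> orbit w x" for x
    using w permutation_permutes permutation_self_in_orbit by metis
  have inter: "?C \<inter> ?U s \<subseteq> ?C" "card (?C \<inter> ?U s) = d a * card {k \<in> A. d k = d a}"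
    if s: "s \<in> placements X w A {} d" for s
  proof -
    note D = placementsD[OF s \<open>finite A\<close> finite.emptyI]
    have orb: "orbit w (s k) = segment w (s k) (d k)" if "k \<in> A" for k
      using orbit_eq_segment D(2) that assms by metis
    have "card (orbit w x) = d k \<and> x \<in> X" if "k \<in> A" "x \<in> segment w (s k) (d k)" for x k
    proof -
      have "orbit w x = orbit w (s k)"
        using that w orb cyclic_on_orbit orbit_cyclic_eq3 by metis
      then show ?thesis
        using D that orb segment_subset[OF w(1)] by force
    qed
    then have "?C \<inter> ?U s = (\<Union>k\<in>{k \<in> A. d k = d a}. segment w (s k) (d k))" by fastforce
    also have "card \<dots> = (\<Sum>k\<in>{k \<in> A. d k = d a}. card (segment w (s k) (d k)))"
    proof (rule card_UN_disjoint)
      show "\<forall>i\<in>{k \<in> A. d k = d a}. \<forall>j\<in>{k \<in> A. d k = d a}. i \<noteq> j \<longrightarrow>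
          segment w (s i) (d i) \<inter> segment w (s j) (d j) = {}"
        using D(4) by blast
    qed (use \<open>finite A\<close> in auto)
    also have "\<dots> = (\<Sum>k\<in>{k \<in> A. d k = d a}. d a)"
    proof (rule sum.cong)
      fix k assume "k \<in> {k \<in> A. d k = d a}"
      then show "card (segment w (s k) (d k)) = d a" using D(3)[of k] by simp
    qed simp
    finally show "card (?C \<inter> ?U s) = d a * card {k \<in> A. d k = d a}" by simp
  qed auto
  have "card (placements X w (insert a A) {} d) = card (placements X w A {} d) * ?q"
  proof (rule card_PiE_insert_fibres)
    show "placements X w (insert a A) {} d = {s \<in> insert a A \<rightarrow>\<^sub>E X.
      restrict s A \<in> placements X w A {} d \<and> s a \<in> ?C - ?U (restrict s A)}"
    proof (intro set_eqI, goal_cases)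
      case (1 s)
      have U: "?U (restrict s A) = ?U s" by auto
      have "card (\<Union>k\<in>insert a A. segment w (s k) (d k)) = (\<Sum>k\<in>insert a A. d k) \<longleftrightarrow>
        card (?U s) = (\<Sum>k\<in>A. d k) \<and> card (segment w (s a) (d a)) = d a \<and>
        segment w (s a) (d a) \<inter> ?U s = {}"
        using assms by (subst card_UN_eq_sum_insert_iff) (auto simp: card_segment_le)
      \<comment> \<open>Orbits are equal or disjoint, so testing the base point is enough.\<close>
      moreover have "segment w (s a) (d a) \<inter> ?U s = {} \<longleftrightarrow> s a \<notin> ?U s"
        if cyc: "\<forall>k\<in>insert a A. (w ^^ d k) (s k) = s k"
      proof -
        have orb: "orbit w (s k) = segment w (s k) (d k)" if "k \<in> insert a A" for k
          using orbit_eq_segment cyc that assms by (metis insert_iff)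
        have sa: "s a \<in> orbit w (s k)" if "k \<in> A" "x \<in> orbit w (s a)" "x \<in> orbit w (s k)" for x k
          using that cyclic_on_orbit[OF w] orbit_cyclic_eq3 self by metis
        show ?thesis
        proof
          assume "s a \<notin> ?U s"
          show "segment w (s a) (d a) \<inter> ?U s = {}"
          proof (rule equals0I)
            fix x assume "x \<in> segment w (s a) (d a) \<inter> ?U s"
            then obtain k where k: "k \<in> A" "x \<in> segment w (s k) (d k)" "x \<in> segment w (s a) (d a)"
              by blast
            then have "s a \<in> segment w (s k) (d k)"
              using sa[of k x] orb[of k] orb[of a] by simp
            with \<open>s a \<notin> ?U s\<close> k(1) show False by blast
          qed
        qed (use start_in_segment[OF \<open>0 < d a\<close>, of "s a" w] in blast)
      qed
      moreover have "card (orbit w (s a)) = d a \<longleftrightarrow>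
          (w ^^ d a) (s a) = s a \<and> card (segment w (s a) (d a)) = d a"
        using card_orbit_eq_iff self assms by metis
      ultimately show ?case unfolding placements_def mem_Collect_eq
        using U by (auto simp: PiE_iff)
    qed
    show "card (?C - ?U s) = ?q" if "s \<in> placements X w A {} d" for s
      using inter(2)[OF that] w(2) by (subst card_Diff_subset_Int) simp_all
  qed (use assms in \<open>auto simp: finite_placements, auto simp: placements_def\<close>)
  moreover have "d a * card {k \<in> A. d k = d a} \<le> card ?C" if "placements X w A {} d \<noteq> {}"
  proof -
    from that obtain s where "s \<in> placements X w A {} d" by blast
    from inter(2)[OF this] card_mono[OF _ inter(1)[OF this]] show ?thesis using w(2) by simp
  qed
  ultimately show ?thesis
    by (cases "placements X w A {} d = {}") (auto simp: of_nat_diff)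
qed

text \<open>When the successor of the last point of path \<open>b\<close> is the source of path
  \<open>c\<close>, the two segments concatenate to one starting at \<open>s b\<close>. The index
  \<open>c\<close> is kept for it; covered set and total size do not change.\<close>

lemma placements_merge_iff:
  fixes s :: "'i \<Rightarrow> 'a"
  assumes "finite A" "finite B" "A \<inter> B = {}" "b \<in> B" "c \<in> B" "b \<noteq> c"
    and s: "s \<in> (A \<union> B) \<rightarrow>\<^sub>E X" "(w ^^ d b) (s b) = s c"
  shows "restrict (s(c := s b)) (A \<union> B - {b}) \<in> placements X w A (B - {b}) (d(c := d b + d c)) \<longleftrightarrow>
    s \<in> placements X w A B d"
proof -
  let ?K = "A \<union> (B - {b})" and ?s = "restrict (s(c := s b)) (A \<union> B - {b})" and ?d = "d(c := d b + d c)"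
  have K: "A \<union> B - {b} = ?K" "A \<union> B = insert b ?K" "?K = insert c (?K - {c})" and b: "b \<notin> ?K"
    using assms by auto
  have "?s \<in> ?K \<rightarrow>\<^sub>E X" using s(1) assms(4) K by (auto simp: PiE_iff)
  moreover have "(\<forall>k\<in>A. (w ^^ ?d k) (?s k) = ?s k) \<longleftrightarrow> (\<forall>k\<in>A. (w ^^ d k) (s k) = s k)"
    using assms by (intro ball_cong) auto
  moreover have "(\<Union>k\<in>?K. segment w (?s k) (?d k)) = (\<Union>k\<in>A \<union> B. segment w (s k) (d k))"
  proof -
    have "(\<Union>k\<in>?K. segment w (?s k) (?d k)) = segment w (?s c) (?d c) \<union> (\<Union>k\<in>?K - {c}. segment w (?s k) (?d k))"
      using K(3) by blast
    also have "segment w (?s c) (?d c) = segment w (s b) (d b) \<union> segment w (s c) (d c)"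
      using assms by (simp add: segment_add)
    also have "(\<Union>k\<in>?K - {c}. segment w (?s k) (?d k)) = (\<Union>k\<in>?K - {c}. segment w (s k) (d k))"
      using assms by (intro SUP_cong) auto
    finally show ?thesis using K(2,3) by blast
  qed
  moreover have "(\<Sum>k\<in>?K. ?d k) = (\<Sum>k\<in>A \<union> B. d k)"
  proof -
    have "(\<Sum>k\<in>?K. ?d k) = ?d c + (\<Sum>k\<in>?K - {c}. ?d k)"
      using assms by (intro sum.remove) auto
    also have "(\<Sum>k\<in>?K - {c}. ?d k) = (\<Sum>k\<in>?K - {c}. d k)"
      by (intro sum.cong) auto
    also have "?d c + \<dots> = d b + (\<Sum>k\<in>?K. d k)"
      using assms by (subst sum.remove[of ?K c]) auto
    also have "\<dots> = (\<Sum>k\<in>A \<union> B. d k)"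
      using assms K(2) b by simp
    finally show ?thesis .
  qed
  ultimately show ?thesis using s(1) by (simp add: placements_def)
qed

lemma card_placements_merge:
  assumes "w permutes X" "finite A" "finite B" "A \<inter> B = {}" "b \<in> B" "c \<in> B" "b \<noteq> c"
  shows "card {s \<in> placements X w A B d. (w ^^ d b) (s b) = s c} =
    card (placements X w A (B - {b}) (d(c := d b + d c)))"
proof (rule bij_betw_same_card[of "\<lambda>s. restrict (s(c := s b)) (A \<union> B - {b})"],
    rule bij_betw_byWitness[where f' = "\<lambda>s. (s(b := s c))(c := (w ^^ d b) (s c))"])
  let ?f = "\<lambda>s. restrict (s(c := s b)) (A \<union> B - {b})"
  \<comment> \<open>Cuts the merged path after \<open>d b\<close> vertices: its source is stored at
    \<open>c\<close> and becomes the source of \<open>b\<close>.\<close>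
  let ?g = "\<lambda>s. (s(b := s c))(c := (w ^^ d b) (s c))"
  let ?S = "{s \<in> placements X w A B d. (w ^^ d b) (s b) = s c}"
  let ?T = "placements X w A (B - {b}) (d(c := d b + d c))"
  have g: "?g s \<in> (A \<union> B) \<rightarrow>\<^sub>E X" "?f (?g s) = s" if "s \<in> ?T" for s
  proof -
    have s: "s \<in> A \<union> (B - {b}) \<rightarrow>\<^sub>E X" using that by (simp add: placements_def)
    then have "s c \<in> X" using assms by auto
    then have "(w ^^ d b) (s c) \<in> X"
      using permutes_in_image[OF permutes_funpow[OF assms(1)]] by blast
    with s \<open>s c \<in> X\<close> show "?g s \<in> (A \<union> B) \<rightarrow>\<^sub>E X"
      using assms by (auto simp: PiE_iff extensional_def)
    have "s x = undefined" if "x \<notin> A \<union> B - {b}" for x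
      using s that assms by (auto simp: PiE_iff extensional_def)
    then show "?f (?g s) = s"
      using assms by (auto simp: fun_eq_iff restrict_def)
  qed
  show "\<forall>s\<in>?S. ?g (?f s) = s"
    using assms by (auto simp: placements_def fun_eq_iff PiE_iff extensional_def)
  show "\<forall>s\<in>?T. ?f (?g s) = s" using g by blast
  show "?f ` ?S \<subseteq> ?T"
  proof
    fix s' assume "s' \<in> ?f ` ?S"
    then obtain s where s: "s \<in> ?S" "s' = ?f s" by blast
    then have "s \<in> (A \<union> B) \<rightarrow>\<^sub>E X" "(w ^^ d b) (s b) = s c" by (simp_all add: placements_def)
    from placements_merge_iff[OF assms(2-7), where d = d, OF this] s show "s' \<in> ?T" by simp
  qed
  show "?g ` ?T \<subseteq> ?S"
  proof
    fix s' assume "s' \<in> ?g ` ?T"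
    then obtain s where s: "s \<in> ?T" "s' = ?g s" by blast
    have "(w ^^ d b) (s' b) = s' c" using s assms by simp
    moreover from this have "s' \<in> placements X w A B d"
      using placements_merge_iff[OF assms(2-7), where d = d and X = X and s = s' and w = w] g[OF s(1)] s by simp
    ultimately show "s' \<in> ?S" by simp
  qed
qed

text \<open>Remove the last vertex of the path \<open>b\<close>. In a placement of what is left, the successor of
  the new end point of \<open>b\<close> is either a fresh point, or it has no preimage in the placed graph,
  hence is the source of \<open>b\<close> itself (closing a cycle) or of another path (merging the two).\<close>
lemma card_placements_shorten_path:
  fixes A B :: "'i set" and X :: "'a set"
  assumes w: "w permutes X" "finite X" and fin: "finite A" "finite B" and disj: "A \<inter> B = {}"
    and b: "b \<in> B" "d b = Suc l" "0 < l" and pos: "\<And>k. k \<in> A \<union> B \<Longrightarrow> 0 < d k"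
  shows "card (placements X w A B (d(b := l))) = card (placements X w A B d) +
    card (placements X w (insert b A) (B - {b}) (d(b := l))) +
    (\<Sum>c\<in>B - {b}. card (placements X w A (B - {b}) (d(c := l + d c))))"
proof -
  define e where "e = d(b := l)"
  have e: "e b = l" "\<And>k. k \<noteq> b \<Longrightarrow> e k = d k" "\<And>k. k \<in> A \<union> B \<Longrightarrow> 0 < e k"
    using b pos by (auto simp: e_def)
  let ?P = "placements X w A B e"
  let ?U = "\<lambda>s. \<Union>k\<in>A \<union> B. segment w (s k) (e k)"
  define P1 where "P1 = {s \<in> ?P. (w ^^ l) (s b) \<notin> ?U s}"
  define P2 where "P2 = {s \<in> ?P. (w ^^ l) (s b) = s b}"
  define P3 where "P3 c = {s \<in> ?P. (w ^^ l) (s b) = s c}" for c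
  have start: "s k \<in> ?U s" if "k \<in> A \<union> B" for s k
    using start_in_segment that e by (metis UN_I)
  have inj_w: "inj w" using w(1) by (rule permutes_inj)
  have cases: "(w ^^ l) (s b) \<in> s ` B" if s: "s \<in> ?P" "(w ^^ l) (s b) \<in> ?U s" for s
  proof -
    note D = placementsD[OF s(1) fin]
    from s(2) obtain k j where k: "k \<in> A \<union> B" "j < e k" "(w ^^ l) (s b) = (w ^^ j) (s k)"
      by (auto simp: segment_def)
    obtain l' where l': "l = Suc l'" using b(3) gr0_conv_Suc by blast
    \<comment> \<open>By injectivity of \<open>w\<close>, the only preimage of the successor of the
      end point is the end point itself, and by disjointness it occurs only at position
      \<open>l'\<close> of path \<open>b\<close>.\<close>
    have no_pred: "k = b \<and> i = l'" if "w ((w ^^ i) (s k)) = (w ^^ l) (s b)" "i < e k" for i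
    proof -
      have eq: "(w ^^ l') (s b) = (w ^^ i) (s k)"
        using that(1) inj_w by (simp add: l' inj_eq)
      have mem: "(w ^^ l') (s b) \<in> segment w (s b) (e b)"  "(w ^^ i) (s k) \<in> segment w (s k) (e k)"
        using that(2) by (auto intro!: funpow_in_segment simp: e l')
      then have "k = b" using D(4)[of k b] k(1) b(1) eq by auto
      moreover have "inj_on (\<lambda>j. (w ^^ j) (s b)) {..<e b}"
        using D(3)[of b] b(1) card_segment_eq_iff by (metis UnCI)
      ultimately show ?thesis
        using eq that(2) e(1) l' by (auto dest!: inj_onD)
    qed
    \<comment> \<open>A point at a positive position has its predecessor in the same segment, which
      would have to be the end of \<open>b\<close>; but then the point has position
      \<open>l\<close>, beyond the shortened path.\<close>
    have "j = 0"
    proof (rule ccontr)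
      assume "j \<noteq> 0"
      then obtain i where i: "j = Suc i" using not0_implies_Suc by blast
      then have "k = b \<and> i = l'" using no_pred[of i] k by simp
      then show False using k(2) i e(1) l' by simp
    qed
    \<comment> \<open>On a cycle even the base point has a predecessor, namely the last
      point.\<close>
    moreover have "k \<notin> A"
    proof
      assume kA: "k \<in> A"
      obtain i where i: "e k = Suc i" using e(3)[of k] k(1) gr0_conv_Suc by blast
      have "w ((w ^^ i) (s k)) = (w ^^ l) (s b)"
        using D(2)[OF kA] i k(3) \<open>j = 0\<close> by simp
      then have "k = b" using no_pred[of i] i by simp
      then show False using kA b(1) disj by blast
    qed
    ultimately show ?thesis using k by auto
  qed
  have finP: "finite ?P" using finite_placements w fin by blast
  have split: "?P = P1 \<union> P2 \<union> (\<Union>c\<in>B - {b}. P3 c)"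
    using cases unfolding P1_def P2_def P3_def by auto
  have inj_s: "s k \<noteq> s k'" if "s \<in> ?P" "k \<in> A \<union> B" "k' \<in> A \<union> B" "k \<noteq> k'" for s k k'
    using placementsD(4)[OF that(1) fin that(2-4)] start_in_segment e(3) that by (metis disjoint_iff)
  have "card ?P = card (P1 \<union> P2) + card (\<Union>c\<in>B - {b}. P3 c)"
    unfolding split
  proof (rule card_Un_disjoint)
    show "(P1 \<union> P2) \<inter> (\<Union>c\<in>B - {b}. P3 c) = {}"
    proof -
      have "P1 \<inter> P3 c = {}" if "c \<in> B - {b}" for c
        unfolding P1_def P3_def using start[of c] that by fastforce
      moreover have "P2 \<inter> P3 c = {}" if c: "c \<in> B - {b}" for c
      proof -
        have "s \<notin> P3 c" if "s \<in> P2" for s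
          using inj_s[of s b c] b(1) c that by (auto simp: P2_def P3_def)
        then show ?thesis by blast
      qed
      ultimately show ?thesis by blast
    qed
  qed (use finP fin in \<open>auto simp: P1_def P2_def P3_def\<close>)
  also have "card (P1 \<union> P2) = card P1 + card P2"
  proof (rule card_Un_disjoint)
    show "P1 \<inter> P2 = {}"
      unfolding P1_def P2_def using start[of b] b(1) by fastforce
  qed (use finP in \<open>auto simp: P1_def P2_def\<close>)
  also have "card (\<Union>c\<in>B - {b}. P3 c) = (\<Sum>c\<in>B - {b}. card (P3 c))"
  proof (rule card_UN_disjoint)
    show "\<forall>i\<in>B - {b}. \<forall>j\<in>B - {b}. i \<noteq> j \<longrightarrow> P3 i \<inter> P3 j = {}"
    proof (intro ballI impI)
      fix i j assume ij: "i \<in> B - {b}" "j \<in> B - {b}" "i \<noteq> j"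
      have "s \<notin> P3 j" if "s \<in> P3 i" for s
        using inj_s[of s i j] ij that by (simp add: P3_def)
      then show "P3 i \<inter> P3 j = {}" by blast
    qed
  qed (use finP fin in \<open>auto simp: P3_def\<close>)
  also have "(\<Sum>c\<in>B - {b}. card (P3 c)) =
    (\<Sum>c\<in>B - {b}. card (placements X w A (B - {b}) (d(c := l + d c))))"
  proof (rule sum.cong)
    fix c assume c: "c \<in> B - {b}"
    then have "card (P3 c) = card (placements X w A (B - {b}) (e(c := e b + e c)))"
      unfolding P3_def using card_placements_merge[OF w(1) fin disj b(1), of c e] e(1) by auto
    also have "placements X w A (B - {b}) (e(c := e b + e c)) = placements X w A (B - {b}) (d(c := l + d c))"
    proof (rule placements_cong)
      fix k assume "k \<in> A \<union> (B - {b})"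
      then have "k \<noteq> b" using disj b(1) by auto
      then show "(e(c := e b + e c)) k = (d(c := l + d c)) k"
        using c e(1) e(2)[of k] e(2)[of c] by simp
    qed
    finally show "card (P3 c) = card (placements X w A (B - {b}) (d(c := l + d c)))" .
  qed simp
  \<comment> \<open>With \<open>e b = l\<close> the condition of \<open>P2\<close> is the closing
    condition of a cycle, so \<open>b\<close> merely changes sides.\<close>
  also have "P2 = placements X w (insert b A) (B - {b}) e"
  proof -
    have "insert b A \<union> (B - {b}) = A \<union> B" using b by auto
    then show ?thesis using e(1) unfolding P2_def placements_def by auto
  qed
  \<comment> \<open>The longer path adds one vertex to the total and at most one point to the cover,
    which stays sharp exactly when that point is fresh.\<close>
  also have "P1 = placements X w A B d"
  proof (intro set_eqI)
    fix s
    let ?K = "A \<union> B - {b}"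
    have K: "A \<union> B = insert b ?K" "b \<notin> ?K" "finite ?K" using b fin by auto
    have V: "(\<Union>k\<in>A \<union> B. segment w (s k) (d k)) = insert ((w ^^ l) (s b)) (?U s)"
    proof -
      have split: "(\<Union>k\<in>A \<union> B. F k) = F b \<union> (\<Union>k\<in>?K. F k)" for F :: "'i \<Rightarrow> 'a set"
        using b(1) by auto
      have "(\<Union>k\<in>?K. segment w (s k) (d k)) = (\<Union>k\<in>?K. segment w (s k) (e k))"
        using e(2) by auto
      then show ?thesis
        unfolding split using e(1) b(2) by (simp add: segment_Suc)
    qed
    have S: "(\<Sum>k\<in>A \<union> B. d k) = Suc (\<Sum>k\<in>A \<union> B. e k)"
    proof -
      have "(\<Sum>k\<in>?K. d k) = (\<Sum>k\<in>?K. e k)" using e(2) by (intro sum.cong) auto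
      then show ?thesis
        using sum.insert[OF K(3,2), of d] sum.insert[OF K(3,2), of e] e(1) b(2) K(1) by simp
    qed
    have finU: "finite (?U s)" using fin by auto
    have leU: "card (?U s) \<le> (\<Sum>k\<in>A \<union> B. e k)"
      using card_UN_le[of "A \<union> B" "\<lambda>k. segment w (s k) (e k)"] fin
        sum_mono[of "A \<union> B" "\<lambda>k. card (segment w (s k) (e k))" e, OF card_segment_le] by simp
    have "(\<forall>k\<in>A. (w ^^ e k) (s k) = s k) \<longleftrightarrow> (\<forall>k\<in>A. (w ^^ d k) (s k) = s k)"
    proof (rule ball_cong)
      fix k assume "k \<in> A"
      then have "k \<noteq> b" using b(1) disj by auto
      then show "(w ^^ e k) (s k) = s k \<longleftrightarrow> (w ^^ d k) (s k) = s k" using e(2) by simp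
    qed simp
    moreover have "card (\<Union>k\<in>A \<union> B. segment w (s k) (d k)) = (\<Sum>k\<in>A \<union> B. d k) \<longleftrightarrow>
      card (?U s) = (\<Sum>k\<in>A \<union> B. e k) \<and> (w ^^ l) (s b) \<notin> ?U s"
      unfolding V S using leU finU by (cases "(w ^^ l) (s b) \<in> ?U s") (auto simp: insert_absorb)
    ultimately show "s \<in> P1 \<longleftrightarrow> s \<in> placements X w A B d"
      unfolding P1_def placements_def by blast
  qed
  finally show ?thesis unfolding e_def .
qed

section \<open>The counting polynomial\<close>

lemma image_mset_set_insertE:
  assumes "finite A" "image_mset d (mset_set A) = add_mset c M"
  obtains a where "a \<in> A" "d a = c" "image_mset d (mset_set (A - {a})) = M"
proof -
  have "c \<in># image_mset d (mset_set A)" using assms by simp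
  then obtain a where a: "a \<in> A" "d a = c" using assms(1) by auto
  then have "image_mset d (mset_set (A - {a})) = M"
    using assms by (simp add: mset_set.remove[of A a])
  with a that show thesis by blast
qed

lemma image_mset_set_upd:
  assumes "finite A"
  shows "a \<in> A \<Longrightarrow> image_mset (d(a := v)) (mset_set A) = add_mset v (image_mset d (mset_set (A - {a})))"
    and "a \<notin> A \<Longrightarrow> image_mset (d(a := v)) (mset_set A) = image_mset d (mset_set A)"
  using assms by (auto simp: mset_set.remove[of A a] intro!: image_mset_cong)

lemma image_mset_set_remove:
  assumes "finite A" "a \<in> A"
  shows "image_mset d (mset_set (A - {a})) = image_mset d (mset_set A) - {#d a#}"
  using assms by (simp add: mset_set.remove[of A a])

lemma count_image_mset_set:
  "finite A \<Longrightarrow> count (image_mset d (mset_set A)) c = card {k \<in> A. d k = c}"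
  by (simp add: count_image_mset' conj_commute eq_commute[of c])

lemma card_points_on_cycles:
  assumes "w permutes {1..n}"
  shows "card {x \<in> {1..n}. card (orbit w x) = c} = c * count (cycle_type n w) c"
proof -
  let ?O = "{orbit w x | x. x \<in> {1..n}}"
  have cyc: "cyclic_on w (orbit w x)" for x
    using cyclic_on_orbit[OF assms] by simp
  have self: "x \<in> orbit w x" for x
    using assms permutation_permutes permutation_self_in_orbit by (metis finite_atLeastAtMost)
  have finO: "finite ?O" by simp
  have "{x \<in> {1..n}. card (orbit w x) = c} = \<Union>{C \<in> ?O. card C = c}"
  proof
    show "\<Union>{C \<in> ?O. card C = c} \<subseteq> {x \<in> {1..n}. card (orbit w x) = c}"
    proof clarify
      fix x y assume xy: "x \<in> orbit w y" "y \<in> {1..n}" "c = card (orbit w y)"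
      then have "orbit w x = orbit w y" using cyc orbit_cyclic_eq3 by metis
      moreover have "x \<in> {1..n}" using xy permutes_orbit_subset[OF assms] by blast
      ultimately show "x \<in> {1..n} \<and> card (orbit w x) = card (orbit w y)" by simp
    qed
  qed (use self in blast)
  also have "card \<dots> = c * card {C \<in> ?O. card C = c}"
  proof (rule card_partition[symmetric])
    show "finite (\<Union>{C \<in> ?O. card C = c})"
      using permutes_orbit_subset[OF assms] by (intro finite_Union) (auto intro: finite_subset)
    show "C1 \<inter> C2 = {}" if "C1 \<in> {C \<in> ?O. card C = c}" "C2 \<in> {C \<in> ?O. card C = c}" "C1 \<noteq> C2" for C1 C2
      using that cyc orbit_cyclic_eq3 by (smt (verit) disjoint_iff mem_Collect_eq)
  qed (use finO in auto)
  also have "card {C \<in> ?O. card C = c} = count (cycle_type n w) c"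
    unfolding cycle_type_def using finO by (rule count_image_mset_set[symmetric])
  finally show ?thesis .
qed

definition type_values :: "nat \<Rightarrow> nat multiset \<Rightarrow> nat \<Rightarrow> real" where
  "type_values n lam = (\<lambda>i. if i = 0 then real n else real (count lam i))"

text \<open>Here and below \<open>\<nu>\<close> collects the numbers of vertices of the paths, so that isolated
  vertices are counted by the parts equal to 1 and no part is 0.\<close>
definition counts_placements :: "nat multiset \<Rightarrow> nat multiset \<Rightarrow> ipoly \<Rightarrow> bool" where
  "counts_placements \<mu> \<nu> f \<longleftrightarrow> (\<forall>n w (A :: nat set set) B d. w permutes {1..n} \<longrightarrow>
     finite A \<longrightarrow> finite B \<longrightarrow> A \<inter> B = {} \<longrightarrow>
     image_mset d (mset_set A) = \<mu> \<longrightarrow> image_mset d (mset_set B) = \<nu> \<longrightarrow>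
     real (card (placements {1..n} w A B d)) = ipoly_eval f (type_values n (cycle_type n w)))"

text \<open>A path with \<open>v\<close> vertices has \<open>v - 1\<close> edges. Closing and
  merging preserve the total, so it also bounds the length of every cycle the recursion can create,
  hence the indices of the variables.\<close>

definition edge_number :: "nat multiset \<Rightarrow> nat multiset \<Rightarrow> nat" where
  "edge_number \<mu> \<nu> = sum_mset \<mu> + (\<Sum>v\<in>#\<nu>. v - 1)"

text \<open>An isolated vertex has no edge but contributes a linear factor in n, hence the
  \<open>max 1\<close>. When all parts of \<nu> are at least 2 this is the number of edges.\<close>

definition weight_bound :: "nat multiset \<Rightarrow> nat multiset \<Rightarrow> nat" where
  "weight_bound \<mu> \<nu> = sum_mset \<mu> + (\<Sum>v\<in>#\<nu>. max 1 (v - 1))"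

text \<open>Nonvanishing of L would not be inductive, since sums could cancel; its sign is. With an
  isolated vertex present, the factor n - const makes the limit 0 instead.\<close>

definition placement_poly :: "nat multiset \<Rightarrow> nat multiset \<Rightarrow> ipoly \<Rightarrow> real \<Rightarrow> bool" where
  "placement_poly \<mu> \<nu> f L \<longleftrightarrow> counts_placements \<mu> \<nu> f \<and>
     ipoly_bounded f (edge_number \<mu> \<nu>) (weight_bound \<mu> \<nu>) \<and>
     leading_limit f (weight_bound \<mu> \<nu>) L \<and>
     (if 1 \<in># \<nu> then L = 0 else 0 < (-1) ^ size \<nu> * L)"

lemma placement_poly_cycles:
  "0 \<notin># \<mu> \<Longrightarrow> \<exists>f L. placement_poly \<mu> {#} f L"
proof (induction \<mu>)
  case empty
  have "placement_poly {#} {#} (of_int 1) 1"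
    using leading_limit_of_int_0[of 1] ipoly_bounded_of_int[of 1] ipoly_eval_of_int[of 1]
    by (auto simp: placement_poly_def counts_placements_def placements_empty weight_bound_def
        mset_set_empty_iff)
  then show ?case by blast
next
  case (add c \<mu>)
  then obtain f L where f: "placement_poly \<mu> {#} f L" and c: "0 < c" by auto
  \<comment> \<open>There are c m_c points on cycles of length c, and each cycle of that length
    placed before occupies c of them. The leading part c m_c multiplies the limit by c.\<close>
  let ?g = "of_int (int c) * ipoly_var c - of_int (int (c * count \<mu> c))"
  have "counts_placements (add_mset c \<mu>) {#} (f * ?g)"
    unfolding counts_placements_def
  proof (intro allI impI)
    fix n :: nat and w and A B :: "nat set set" and d
    assume w: "w permutes {1..n}" and fin: "finite A" "finite B" and disj: "A \<inter> B = {}"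
      and A: "image_mset d (mset_set A) = add_mset c \<mu>" and "image_mset d (mset_set B) = {#}"
    then have B: "B = {}" by (simp add: mset_set_empty_iff)
    obtain a where a: "a \<in> A" "d a = c" "image_mset d (mset_set (A - {a})) = \<mu>"
      using fin(1) A by (rule image_mset_set_insertE)
    have pos: "0 < d k" if "k \<in> A - {a}" for k
      using add.prems a(3) fin that by (metis (no_types, lifting) finite_Diff finite_set_mset_mset_set
          gr0I image_eqI insertCI set_image_mset set_mset_add_mset_insert)
    have "real (card (placements {1..n} w (insert a (A - {a})) {} d)) =
      real (card (placements {1..n} w (A - {a}) {} d)) *
      (real (card {x \<in> {1..n}. card (orbit w x) = d a}) - real (d a) * real (card {k \<in> A - {a}. d k = d a}))"
      using w fin pos c a by (intro card_placements_insert_cycle) auto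
    also have "insert a (A - {a}) = A" using a by blast
    also have "card {x \<in> {1..n}. card (orbit w x) = d a} = c * count (cycle_type n w) c"
      using card_points_on_cycles[OF w] a by simp
    also have "card {k \<in> A - {a}. d k = d a} = count \<mu> c"
      using count_image_mset_set[of "A - {a}" d c] a fin by simp
    also have "real (card (placements {1..n} w (A - {a}) {} d)) = ipoly_eval f (type_values n (cycle_type n w))"
      using f a w fin unfolding placement_poly_def counts_placements_def by simp
    finally show "real (card (placements {1..n} w A B d)) = ipoly_eval (f * ?g) (type_values n (cycle_type n w))"
      using c a by (simp add: B ipoly_eval_mult ipoly_eval_diff type_values_def)
  qed
  moreover have "ipoly_bounded (f * ?g) (edge_number (add_mset c \<mu>) {#}) (weight_bound (add_mset c \<mu>) {#})"
  proof -
    have "ipoly_bounded f (sum_mset \<mu> + c) (sum_mset \<mu>)"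
      by (rule ipoly_bounded_mono[of _ "sum_mset \<mu>" "sum_mset \<mu>"])
         (use f in \<open>simp_all add: placement_poly_def edge_number_def weight_bound_def\<close>)
    moreover have "ipoly_bounded ?g (sum_mset \<mu> + c) (0 + c)"
      using c by (intro ipoly_bounded_diff ipoly_bounded_mult ipoly_bounded_of_int ipoly_bounded_var) auto
    ultimately have "ipoly_bounded (f * ?g) (sum_mset \<mu> + c) (sum_mset \<mu> + (0 + c))"
      by (rule ipoly_bounded_mult)
    then show ?thesis by (simp add: edge_number_def weight_bound_def add.commute)
  qed
  moreover have "leading_limit (f * ?g) (weight_bound (add_mset c \<mu>) {#}) (L * c)"
  proof -
    have "leading_limit ?g (0 + c) (of_int (int c) * 1 - 0)"
      using c by (intro leading_limit_diff leading_limit_mult leading_limit_of_int_0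
          leading_limit_var leading_limit_of_int) auto
    moreover have "leading_limit f (sum_mset \<mu>) L"
      using f by (simp add: placement_poly_def weight_bound_def)
    ultimately have "leading_limit (f * ?g) (sum_mset \<mu> + (0 + c)) (L * (of_int (int c) * 1 - 0))"
      by (rule leading_limit_mult[rotated])
    then show ?thesis by (simp add: weight_bound_def add.commute)
  qed
  moreover have "0 < L" using f by (simp add: placement_poly_def)
  ultimately have "placement_poly (add_mset c \<mu>) {#} (f * ?g) (L * c)"
    using c by (simp add: placement_poly_def)
  then show ?case by blast
qed

text \<open>Of the n points, \<open>m\<close> are occupied. On the test curve n is 0 and a constant
  is negligible against t, so the new factor has limit 0.\<close>

lemma placement_poly_isolated:
  assumes "placement_poly \<mu> \<nu> f L" and m: "m = sum_mset \<mu> + sum_mset \<nu>"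
  shows "placement_poly \<mu> (add_mset 1 \<nu>) (f * (ipoly_var 0 - of_int (int m))) 0"
proof -
  let ?g = "ipoly_var 0 - of_int (int m)"
  have "counts_placements \<mu> (add_mset 1 \<nu>) (f * ?g)"
    unfolding counts_placements_def
  proof (intro allI impI)
    fix n :: nat and w and A B :: "nat set set" and d
    assume w: "w permutes {1..n}" and fin: "finite A" "finite B" and disj: "A \<inter> B = {}"
      and A: "image_mset d (mset_set A) = \<mu>" and B: "image_mset d (mset_set B) = add_mset 1 \<nu>"
    obtain b where b: "b \<in> B" "d b = 1" "image_mset d (mset_set (B - {b})) = \<nu>"
      using fin(2) B by (rule image_mset_set_insertE)
    have "real (card (placements {1..n} w A (insert b (B - {b})) d)) =
      real (card (placements {1..n} w A (B - {b}) d)) *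
      (real (card {1..n}) - real (\<Sum>k\<in>A \<union> (B - {b}). d k))"
      using w fin disj b by (intro card_placements_isolated) auto
    also have "insert b (B - {b}) = B" using b by blast
    also have "(\<Sum>k\<in>A \<union> (B - {b}). d k) = m"
      unfolding m using A b(3) fin disj by (subst sum.union_disjoint) (auto simp: sum_unfold_sum_mset)
    also have "real (card (placements {1..n} w A (B - {b}) d)) = ipoly_eval f (type_values n (cycle_type n w))"
    proof -
      have "A \<inter> (B - {b}) = {}" using disj by blast
      then show ?thesis
        using assms A b w fin unfolding placement_poly_def counts_placements_def by simp
    qed
    finally show "real (card (placements {1..n} w A B d)) = ipoly_eval (f * ?g) (type_values n (cycle_type n w))"
      by (simp add: ipoly_eval_mult ipoly_eval_diff type_values_def)
  qed
  moreover have "ipoly_bounded (f * ?g) (edge_number \<mu> \<nu>) (weight_bound \<mu> \<nu> + 1)"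
    using assms(1) unfolding placement_poly_def
    by (intro ipoly_bounded_mult ipoly_bounded_diff ipoly_bounded_var ipoly_bounded_of_int) auto
  moreover have "leading_limit (f * ?g) (weight_bound \<mu> \<nu> + 1) (L * (0 - 0))"
    using assms(1) unfolding placement_poly_def
    by (intro leading_limit_mult leading_limit_diff leading_limit_var_0 leading_limit_of_int) auto
  ultimately show ?thesis
    by (simp add: placement_poly_def edge_number_def weight_bound_def add_ac)
qed

text \<open>The counts depend on the sizes only, so the sum over the other paths becomes a sum over
  \<nu> with multiplicity, and the identity can be solved for the longer path.\<close>

lemma counts_placements_shorten_path:
  assumes "0 < l" "0 \<notin># \<mu>" "0 \<notin># \<nu>"
    and g1: "counts_placements \<mu> (add_mset l \<nu>) g1"
    and g2: "counts_placements (add_mset l \<mu>) \<nu> g2"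
    and g3: "\<And>u. u \<in># \<nu> \<Longrightarrow> counts_placements \<mu> (add_mset (l + u) (\<nu> - {#u#})) (g3 u)"
  shows "counts_placements \<mu> (add_mset (Suc l) \<nu>) (g1 - g2 - (\<Sum>u\<in>#\<nu>. g3 u))"
  unfolding counts_placements_def
proof (intro allI impI)
  fix n :: nat and w and A B :: "nat set set" and d
  assume w: "w permutes {1..n}" and fin: "finite A" "finite B" and disj: "A \<inter> B = {}"
    and A: "image_mset d (mset_set A) = \<mu>" and B: "image_mset d (mset_set B) = add_mset (Suc l) \<nu>"
  let ?x = "type_values n (cycle_type n w)"
  obtain b where b: "b \<in> B" "d b = Suc l" "image_mset d (mset_set (B - {b})) = \<nu>"
    using fin(2) B by (rule image_mset_set_insertE)
  have b_notin: "b \<notin> A" using b(1) disj by blast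
  have pos: "0 < d k" if "k \<in> A \<union> B" for k
  proof -
    have "d k \<in># image_mset d (mset_set A) + image_mset d (mset_set B)" using that fin by auto
    then show ?thesis using assms(2,3) A B by (metis add_mset_add_single gr0I nat.simps(3) union_iff set_mset_add_mset_insert insertE)
  qed
  have "card (placements {1..n} w A B (d(b := l))) = card (placements {1..n} w A B d) +
    card (placements {1..n} w (insert b A) (B - {b}) (d(b := l))) +
    (\<Sum>c\<in>B - {b}. card (placements {1..n} w A (B - {b}) (d(c := l + d c))))"
    using w fin disj b assms(1) pos by (intro card_placements_shorten_path) auto
  moreover have "real (card (placements {1..n} w A B (d(b := l)))) = ipoly_eval g1 ?x"
    using g1[unfolded counts_placements_def, rule_format, OF w fin disj, of "d(b := l)"]
      image_mset_set_upd(2)[OF fin(1) b_notin, of d l] image_mset_set_upd(1)[OF fin(2) b(1), of d l] A b(3)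
    by simp
  moreover have "real (card (placements {1..n} w (insert b A) (B - {b}) (d(b := l)))) = ipoly_eval g2 ?x"
  proof -
    have "image_mset (d(b := l)) (mset_set (insert b A)) = add_mset l \<mu>"
      using image_mset_set_upd(1)[of "insert b A" b d l] fin b_notin A by simp
    moreover have "image_mset (d(b := l)) (mset_set (B - {b})) = \<nu>"
      using image_mset_set_upd(2)[of "B - {b}" b d l] fin b(3) by simp
    moreover have "insert b A \<inter> (B - {b}) = {}" using disj by blast
    ultimately show ?thesis
      using g2[unfolded counts_placements_def, rule_format, OF w, of "insert b A" "B - {b}" "d(b := l)"] fin
      by simp
  qed
  moreover have "real (\<Sum>c\<in>B - {b}. card (placements {1..n} w A (B - {b}) (d(c := l + d c)))) =
    (\<Sum>u\<in>#\<nu>. ipoly_eval (g3 u) ?x)"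
  proof -
    have "real (card (placements {1..n} w A (B - {b}) (d(c := l + d c)))) = ipoly_eval (g3 (d c)) ?x"
      if c: "c \<in> B - {b}" for c
    proof -
      have "d c \<in># \<nu>" using c b(3) fin by (auto simp flip: b(3))
      moreover have "image_mset (d(c := l + d c)) (mset_set A) = \<mu>"
        using image_mset_set_upd(2)[of A c d] c disj fin A by auto
      moreover have "image_mset (d(c := l + d c)) (mset_set (B - {b})) = add_mset (l + d c) (\<nu> - {#d c#})"
        using image_mset_set_upd(1)[of "B - {b}" c d] image_mset_set_remove[of "B - {b}" c d] c fin b(3)
        by simp
      moreover have "A \<inter> (B - {b}) = {}" using disj by blast
      ultimately show ?thesis
        using g3[unfolded counts_placements_def, rule_format, OF _ w, of "d c" A "B - {b}" "d(c := l + d c)"] fin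
        by simp
    qed
    then have "real (\<Sum>c\<in>B - {b}. card (placements {1..n} w A (B - {b}) (d(c := l + d c)))) =
      (\<Sum>c\<in>B - {b}. ipoly_eval (g3 (d c)) ?x)"
      by simp
    also have "\<dots> = (\<Sum>u\<in>#\<nu>. ipoly_eval (g3 u) ?x)"
      by (simp add: sum_unfold_sum_mset image_mset.compositionality o_def flip: b(3))
    finally show ?thesis .
  qed
  ultimately show "real (card (placements {1..n} w A B d)) = ipoly_eval (g1 - g2 - (\<Sum>u\<in>#\<nu>. g3 u)) ?x"
    by (simp add: ipoly_eval_diff ipoly_eval_sum_mset)
qed

text \<open>Merging with an isolated vertex would lower the weight; as \<nu> has no part 1,
  \<open>g2\<close> and all \<open>g3 u\<close> have exactly the weight bound of the target. Their
  graphs have one path fewer, which the minus sign in front compensates.\<close>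

lemma placement_poly_shorten_path:
  assumes l: "0 < l" and "0 \<notin># \<mu>" "0 \<notin># \<nu>" "1 \<notin># \<nu>"
    and g1: "placement_poly \<mu> (add_mset l \<nu>) g1 L1"
    and g2: "placement_poly (add_mset l \<mu>) \<nu> g2 L2"
    and g3: "\<And>u. u \<in># \<nu> \<Longrightarrow> placement_poly \<mu> (add_mset (l + u) (\<nu> - {#u#})) (g3 u) (L3 u)"
  shows "placement_poly \<mu> (add_mset (Suc l) \<nu>) (g1 - g2 - (\<Sum>u\<in>#\<nu>. g3 u)) (0 - L2 - (\<Sum>u\<in>#\<nu>. L3 u))"
proof -
  let ?D = "weight_bound \<mu> (add_mset (Suc l) \<nu>)" and ?E = "edge_number \<mu> (add_mset (Suc l) \<nu>)"
  have D2: "weight_bound (add_mset l \<mu>) \<nu> = ?D" "edge_number (add_mset l \<mu>) \<nu> = ?E"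
    using l by (simp_all add: weight_bound_def edge_number_def)
  have D3: "weight_bound \<mu> (add_mset (l + u) (\<nu> - {#u#})) = ?D"
    "edge_number \<mu> (add_mset (l + u) (\<nu> - {#u#})) = ?E" if u: "u \<in># \<nu>" for u
  proof -
    obtain \<nu>' where \<nu>': "\<nu> = add_mset u \<nu>'" using u by (metis insert_DiffM)
    have "u \<noteq> 0" "u \<noteq> 1" using u assms(3,4) by metis+
    then have "2 \<le> u" by simp
    then show "weight_bound \<mu> (add_mset (l + u) (\<nu> - {#u#})) = ?D"
      "edge_number \<mu> (add_mset (l + u) (\<nu> - {#u#})) = ?E"
      using l by (simp_all add: \<nu>' weight_bound_def edge_number_def)
  qed
  have D1: "weight_bound \<mu> (add_mset l \<nu>) \<le> ?D" "edge_number \<mu> (add_mset l \<nu>) \<le> ?E"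
    by (simp_all add: weight_bound_def edge_number_def)
  have "counts_placements \<mu> (add_mset (Suc l) \<nu>) (g1 - g2 - (\<Sum>u\<in>#\<nu>. g3 u))"
    using assms by (intro counts_placements_shorten_path) (auto simp: placement_poly_def)
  moreover have "ipoly_bounded (g1 - g2 - (\<Sum>u\<in>#\<nu>. g3 u)) ?E ?D"
  proof (intro ipoly_bounded_diff ipoly_bounded_sum_mset)
    show "ipoly_bounded g1 ?E ?D"
      using g1 D1 ipoly_bounded_mono unfolding placement_poly_def by blast
    show "ipoly_bounded g2 ?E ?D"
      using g2 D2 unfolding placement_poly_def by simp
    show "ipoly_bounded (g3 u) ?E ?D" if "u \<in># \<nu>" for u
      using g3[OF that] D3[OF that] unfolding placement_poly_def by simp
  qed
  moreover have "leading_limit (g1 - g2 - (\<Sum>u\<in>#\<nu>. g3 u)) ?D (0 - L2 - (\<Sum>u\<in>#\<nu>. L3 u))"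
  proof (intro leading_limit_diff leading_limit_sum_mset)
    show "leading_limit g1 ?D 0"
    \<comment> \<open>For \<open>l = 1\<close> the weight bound does not drop, but the shortened
      path is isolated and the invariant gives limit 0.\<close>
    proof (cases "l = 1")
      case True
      then show ?thesis using g1 by (auto simp: placement_poly_def weight_bound_def)
    next
      case False
      then have "weight_bound \<mu> (add_mset l \<nu>) < ?D"
        using l by (simp add: weight_bound_def)
      then show ?thesis
        using g1 leading_limit_0_if_bounded unfolding placement_poly_def by blast
    qed
    show "leading_limit g2 ?D L2"
      using g2 D2 unfolding placement_poly_def by simp
    show "leading_limit (g3 u) ?D (L3 u)" if "u \<in># \<nu>" for u
      using g3[OF that] D3[OF that] unfolding placement_poly_def by simp
  qed
  moreover have "0 < (-1) ^ size (add_mset (Suc l) \<nu>) * (0 - L2 - (\<Sum>u\<in>#\<nu>. L3 u))"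
  proof -
    have "0 < (-1) ^ size \<nu> * L2" using g2 assms(4) by (simp add: placement_poly_def)
    \<comment> \<open>Only a weak inequality, since \<nu> may be empty; strictness comes from
      closing the path.\<close>
    moreover have "0 \<le> (-1) ^ size \<nu> * (\<Sum>u\<in>#\<nu>. L3 u)"
    proof -
      have "0 \<le> (-1) ^ size \<nu> * L3 u" if u: "u \<in># \<nu>" for u
      proof -
        have "size (add_mset (l + u) (\<nu> - {#u#})) = size \<nu>"
          using u by (metis insert_DiffM size_add_mset)
        moreover have "1 \<notin># add_mset (l + u) (\<nu> - {#u#})"
        proof -
          have "u \<noteq> 0" using u assms(3) by metis
          then show ?thesis using assms(1,4) by (auto dest: in_diffD)
        qed
        ultimately show ?thesis using g3[OF u] by (simp add: placement_poly_def)
      qed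
      then have "(\<Sum>u\<in>#\<nu>. 0) \<le> (\<Sum>u\<in>#\<nu>. (-1) ^ size \<nu> * L3 u)"
        by (rule sum_mset_mono)
      then show ?thesis by (simp add: sum_mset_distrib_left)
    qed
    ultimately show ?thesis by (simp add: algebra_simps)
  qed
  ultimately show ?thesis using l assms(4) unfolding placement_poly_def by auto
qed

text \<open>Induction on the number of path vertices: closing removes a whole path from \<nu>,
  shortening and merging lose one vertex. Isolated vertices are peeled off before any path is
  shortened, as the weight count for merging requires.\<close>

lemma placement_poly_exists:
  "0 \<notin># \<mu> \<Longrightarrow> 0 \<notin># \<nu> \<Longrightarrow> \<exists>f L. placement_poly \<mu> \<nu> f L"
proof (induction "sum_mset \<nu>" arbitrary: \<mu> \<nu> rule: less_induct)
  case less
  consider "\<nu> = {#}" | "1 \<in># \<nu>" | v where "1 \<notin># \<nu>" "v \<in># \<nu>"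
    by (metis multiset_nonemptyE)
  then show ?case
  proof cases
    case 1
    then show ?thesis using placement_poly_cycles less.prems by blast
  next
    case 2
    then obtain \<nu>' where \<nu>: "\<nu> = add_mset 1 \<nu>'" by (metis insert_DiffM)
    then have "\<exists>f L. placement_poly \<mu> \<nu>' f L" using less by auto
    then show ?thesis unfolding \<nu> using placement_poly_isolated by blast
  next
    case 3
    then obtain \<nu>' where \<nu>': "\<nu> = add_mset v \<nu>'" by (metis insert_DiffM)
    have "v \<noteq> 0" "v \<noteq> 1" using 3 less.prems by metis+
    then obtain l where l: "v = Suc l" "0 < l" by (metis One_nat_def gr0I not0_implies_Suc)
    have z: "0 \<notin># \<nu>'" "1 \<notin># \<nu>'" using less.prems 3 \<nu>' by auto
    obtain g1 L1 where g1: "placement_poly \<mu> (add_mset l \<nu>') g1 L1"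
      using less.hyps[of "add_mset l \<nu>'" \<mu>] less.prems l z \<nu>' by auto
    obtain g2 L2 where g2: "placement_poly (add_mset l \<mu>) \<nu>' g2 L2"
      using less.hyps[of \<nu>' "add_mset l \<mu>"] less.prems l z \<nu>' by auto
    have "\<exists>g L. placement_poly \<mu> (add_mset (l + u) (\<nu>' - {#u#})) g L" if u: "u \<in># \<nu>'" for u
    proof (rule less.hyps)
      obtain \<nu>'' where "\<nu>' = add_mset u \<nu>''" using u by (metis insert_DiffM)
      then show "sum_mset (add_mset (l + u) (\<nu>' - {#u#})) < sum_mset \<nu>"
        using l by (simp add: \<nu>')
    qed (use less.prems l z in \<open>auto dest: in_diffD\<close>)
    then obtain g3 L3 where "\<And>u. u \<in># \<nu>' \<Longrightarrow> placement_poly \<mu> (add_mset (l + u) (\<nu>' - {#u#})) (g3 u) (L3 u)"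
      by metis
    from placement_poly_shorten_path[OF l(2) less.prems(1) z g1 g2 this] show ?thesis
      unfolding \<nu>' l(1) by blast
  qed
qed

section \<open>The graph of a partial permutation\<close>

locale partial_permutation =
  fixes I J :: "nat list"
  assumes length_eq: "length I = length J" and distinct_I: "distinct I" and distinct_J: "distinct J"
begin

text \<open>Unspecified outside \<open>set I\<close>, so a walk may be followed only while its
  points lie in \<open>set I\<close>; the lemmas on iterates carry this condition.\<close>

definition next_vertex :: "nat \<Rightarrow> nat" where
  "next_vertex x = the (map_of (zip I J) x)"

abbreviation vertices :: "nat set" where
  "vertices \<equiv> set I \<union> set J"

section \<open>Walks and connected components\<close>

lemma next_vertex_nth: "l < length I \<Longrightarrow> next_vertex (I ! l) = J ! l"
  by (simp add: next_vertex_def map_of_zip_nth length_eq distinct_I)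

lemma next_vertex_inj: "x \<in> set I \<Longrightarrow> y \<in> set I \<Longrightarrow> next_vertex x = next_vertex y \<Longrightarrow> x = y"
  by (metis distinct_J in_set_conv_nth length_eq next_vertex_nth nth_eq_iff_index_eq)

lemma next_vertex_in_J: "x \<in> set I \<Longrightarrow> next_vertex x \<in> set J"
  by (metis in_set_conv_nth length_eq next_vertex_nth)

lemma in_J_E:
  assumes "y \<in> set J"
  obtains x where "x \<in> set I" "next_vertex x = y"
  using assms by (metis in_set_conv_nth length_eq next_vertex_nth)

lemma adj_iff: "adj I J x y \<longleftrightarrow> x \<in> set I \<and> next_vertex x = y \<or> y \<in> set I \<and> next_vertex y = x"
  unfolding adj_def by (metis in_set_conv_nth next_vertex_nth)

lemma edges_in_eq: "edges_in I J C = card (C \<inter> set I)"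
proof -
  have "bij_betw ((!) I) {l. l < length I \<and> I ! l \<in> C} (C \<inter> set I)"
    using distinct_I by (auto simp: bij_betw_def inj_on_def nth_eq_iff_index_eq set_conv_nth)
  then show ?thesis by (simp add: edges_in_def bij_betw_same_card)
qed

lemma component_sym: "y \<in> component I J x \<Longrightarrow> x \<in> component I J y"
proof -
  have "symp (adj I J)" by (rule sympI) (auto simp: adj_iff)
  then show "y \<in> component I J x \<Longrightarrow> x \<in> component I J y"
    unfolding component_def using symp_rtranclp[of "adj I J"] by (auto dest: sympD)
qed

lemma component_eqI: "y \<in> component I J x \<Longrightarrow> component I J y = component I J x"
  using component_sym unfolding component_def by (auto intro: rtranclp_trans)

lemma component_self: "x \<in> component I J x"
  by (simp add: component_def)

lemma component_closed: "y \<in> component I J x \<Longrightarrow> adj I J y z \<Longrightarrow> z \<in> component I J x"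
  unfolding component_def by auto

text \<open>Minimality of components; the main use is for an explicit segment shown to be closed
  under adjacency.\<close>

lemma component_subset:
  assumes "x \<in> S" "\<And>y z. y \<in> S \<Longrightarrow> adj I J y z \<Longrightarrow> z \<in> S"
  shows "component I J x \<subseteq> S"
proof
  fix y assume "y \<in> component I J x"
  then have "(adj I J)\<^sup>*\<^sup>* x y" by (simp add: component_def)
  then show "y \<in> S" by (induction rule: rtranclp_induct) (use assms in auto)
qed

lemma component_subset_vertices: "x \<in> vertices \<Longrightarrow> component I J x \<subseteq> vertices"
  by (rule component_subset) (auto simp: adj_iff next_vertex_in_J)

lemma finite_component: "x \<in> vertices \<Longrightarrow> finite (component I J x)"
  using component_subset_vertices by (rule finite_subset) auto

lemma component_funpow:
  "(\<And>j. j < k \<Longrightarrow> (next_vertex ^^ j) x \<in> set I) \<Longrightarrow> (next_vertex ^^ k) x \<in> component I J x"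
proof (induction k)
  case (Suc k)
  then have "(next_vertex ^^ k) x \<in> component I J x" "(next_vertex ^^ k) x \<in> set I" by simp_all
  then show ?case using component_closed[of "(next_vertex ^^ k) x" x] by (simp add: adj_iff)
qed (simp add: component_self)

text \<open>Predecessors in \<open>set I\<close> are unique. Hence the first point that a walk
  repeats is its start; it cannot enter a loop from outside.\<close>

lemma funpow_cancel:
  assumes "(next_vertex ^^ i) x = (next_vertex ^^ (i + k)) x"
    and "\<And>j. j < i + k \<Longrightarrow> (next_vertex ^^ j) x \<in> set I"
  shows "(next_vertex ^^ k) x = x"
  using assms
proof (induction i)
  case (Suc i)
  have "next_vertex ((next_vertex ^^ i) x) = next_vertex ((next_vertex ^^ (i + k)) x)"
    using Suc.prems(1) by (simp only: add_Suc funpow.simps o_apply)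
  then have "(next_vertex ^^ i) x = (next_vertex ^^ (i + k)) x"
    by (rule next_vertex_inj[rotated 2]) (simp_all add: Suc.prems(2))
  then show ?case by (rule Suc.IH) (simp add: Suc.prems(2))
qed simp

lemma funpow_return:
  assumes "\<And>j. (next_vertex ^^ j) x \<in> set I"
  shows "\<exists>k>0. (next_vertex ^^ k) x = x"
proof -
  have "range (\<lambda>j. (next_vertex ^^ j) x) \<subseteq> set I" using assms by blast
  then have "finite (range (\<lambda>j. (next_vertex ^^ j) x))" by (rule finite_subset) simp
  then have "\<not> inj (\<lambda>j. (next_vertex ^^ j) x)" using finite_imageD by blast
  then obtain i j where ij: "i < j" "(next_vertex ^^ i) x = (next_vertex ^^ j) x"
    unfolding inj_def by (metis linorder_neqE_nat)
  then have "(next_vertex ^^ (j - i)) x = x"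
    using funpow_cancel[of i x "j - i"] assms by simp
  with ij(1) show ?thesis by (intro exI[of _ "j - i"]) auto
qed

lemma card_segment_next_vertex:
  assumes "\<And>j. Suc j < d \<Longrightarrow> (next_vertex ^^ j) x \<in> set I"
    and "\<And>k. 0 < k \<Longrightarrow> k < d \<Longrightarrow> (next_vertex ^^ k) x \<noteq> x"
  shows "card (segment next_vertex x d) = d"
  unfolding card_segment_eq_iff
proof (rule linorder_inj_onI)
  fix i j assume ij: "i < j" "j \<in> {..<d}"
  show "(next_vertex ^^ i) x \<noteq> (next_vertex ^^ j) x"
  proof
    assume "(next_vertex ^^ i) x = (next_vertex ^^ j) x"
    then have "(next_vertex ^^ (j - i)) x = x"
      using funpow_cancel[of i x "j - i"] ij assms(1) by simp
    moreover have "0 < j - i" "j - i < d" using ij by auto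
    ultimately show False using assms(2) by blast
  qed
qed auto

text \<open>Every component is traversed from a suitable vertex: the source of a path, or any vertex
  of a cycle.\<close>
lemma component_traversal:
  assumes x: "x \<in> vertices" and C: "C = component I J x"
  shows "\<exists>a\<in>C. segment next_vertex a (card C) = C \<and>
    (\<forall>j. Suc j < card C \<longrightarrow> (next_vertex ^^ j) a \<in> set I) \<and>
    (C \<subseteq> set I \<and> (next_vertex ^^ card C) a = a \<or>
     C \<inter> set I = C - {(next_vertex ^^ (card C - 1)) a})"
\<comment> \<open>A vertex outside \<open>set J\<close> has no incoming edge and is the source of a
  path. If there is none, counting shows that there is no sink either.\<close>
proof (cases "C \<subseteq> set J")
  case False
  then obtain a where a: "a \<in> C" "a \<notin> set J" by blast
  have Ca: "C = component I J a" using a(1) component_eqI C by blast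
  have "\<exists>j. (next_vertex ^^ j) a \<notin> set I"
  proof (rule ccontr)
    assume "\<not> ?thesis"
    then obtain k where "0 < k" "(next_vertex ^^ k) a = a" "(next_vertex ^^ (k - 1)) a \<in> set I"
      using funpow_return[of a] by blast
    then have "a \<in> set J" using next_vertex_in_J[of "(next_vertex ^^ (k - 1)) a"]
      by (cases k) simp_all
    then show False using a(2) by blast
  qed
  \<comment> \<open>Number of steps to the sink, which exists because a return to \<open>a\<close>
    would give \<open>a\<close> a predecessor.\<close>
  define l where "l = (LEAST j. (next_vertex ^^ j) a \<notin> set I)"
  have l: "(next_vertex ^^ l) a \<notin> set I" "\<And>j. j < l \<Longrightarrow> (next_vertex ^^ j) a \<in> set I"
    unfolding l_def using \<open>\<exists>j. _\<close> LeastI_ex not_less_Least by (metis (mono_tags, lifting))+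
  let ?S = "segment next_vertex a (Suc l)"
  have "C = ?S"
  proof
    show "?S \<subseteq> C"
      unfolding Ca segment_def using l(2) component_funpow[of _ a] by fastforce
    show "C \<subseteq> ?S"
      unfolding Ca
    proof (rule component_subset)
      show "a \<in> ?S" by (rule start_in_segment) simp
      fix y z assume "y \<in> ?S" "adj I J y z"
      then obtain j where "j \<in> {..<Suc l}" and y: "y = (next_vertex ^^ j) a"
        unfolding segment_def by blast
      then have j: "j \<le> l" "y = (next_vertex ^^ j) a" by simp_all
      from \<open>adj I J y z\<close> show "z \<in> ?S"
        unfolding adj_iff
      proof
        assume y: "y \<in> set I \<and> next_vertex y = z"
        then have "j \<noteq> l" using l(1) j by metis
        then show ?thesis
          using funpow_in_segment[of "Suc j" "Suc l" next_vertex a] y j by simp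
      next
        assume z: "z \<in> set I \<and> next_vertex z = y"
        then have "j \<noteq> 0" using a(2) next_vertex_in_J j by (metis funpow_0)
        then obtain i where i: "j = Suc i" using not0_implies_Suc by blast
        then have "next_vertex z = next_vertex ((next_vertex ^^ i) a)" "(next_vertex ^^ i) a \<in> set I"
          using z j l(2)[of i] by simp_all
        then have "z = (next_vertex ^^ i) a"
          using z next_vertex_inj by blast
        then show ?thesis using funpow_in_segment[of i "Suc l" next_vertex a] i j by simp
      qed
    qed
  qed
  moreover have "card ?S = Suc l"
  proof (rule card_segment_next_vertex)
    fix k assume k: "0 < k" "k < Suc l"
    then obtain i where i: "k = Suc i" using gr0_conv_Suc by blast
    then have "(next_vertex ^^ k) a \<in> set J" using k l(2)[of i] next_vertex_in_J by simp
    then show "(next_vertex ^^ k) a \<noteq> a" using a(2) by metis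
  qed (use l in simp)
  moreover have "C \<inter> set I = C - {(next_vertex ^^ l) a}"
    using l unfolding \<open>C = ?S\<close> segment_def by (auto simp: less_Suc_eq)
  ultimately show ?thesis using a(1) l(2) by (intro bexI[of _ a]) auto
next
  case True
  have fin: "finite C" using finite_component x C by blast
  \<comment> \<open>Every vertex of \<open>C\<close> has a predecessor, so
    \<open>next_vertex\<close> maps \<open>C \<inter> set I\<close> onto \<open>C\<close>; by
    cardinality, no vertex of \<open>C\<close> lacks an outgoing edge.\<close>
  have "next_vertex ` (C \<inter> set I) = C"
  proof
    show "next_vertex ` (C \<inter> set I) \<subseteq> C" using component_closed C by (auto simp: adj_iff)
    show "C \<subseteq> next_vertex ` (C \<inter> set I)"
    proof
      fix y assume y: "y \<in> C"
      then obtain z where z: "z \<in> set I" "next_vertex z = y" using True in_J_E by blast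
      then have "z \<in> C" using y component_closed[of y x z] C by (simp add: adj_iff)
      with z show "y \<in> next_vertex ` (C \<inter> set I)" by blast
    qed
  qed
  then have "card C \<le> card (C \<inter> set I)" using fin by (metis card_image_le finite_Int)
  then have CI: "C \<subseteq> set I" using fin card_seteq[of C "C \<inter> set I"] by auto
  have xC: "x \<in> C" using component_self C by simp
  have inC: "(next_vertex ^^ j) x \<in> C" for j
  proof (induction j)
    case (Suc j)
    then show ?case using component_closed[of "(next_vertex ^^ j) x" x] CI C by (auto simp: adj_iff)
  qed (simp add: xC)
  define c where "c = (LEAST k. 0 < k \<and> (next_vertex ^^ k) x = x)"
  have "\<exists>k>0. (next_vertex ^^ k) x = x" using funpow_return inC CI by blast
  then have c: "0 < c" "(next_vertex ^^ c) x = x"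
    unfolding c_def by (metis (mono_tags, lifting) LeastI_ex)+
  have c_min: "(next_vertex ^^ k) x \<noteq> x" if "0 < k" "k < c" for k
    using that not_less_Least unfolding c_def by blast
  let ?S = "segment next_vertex x c"
  have "C = ?S"
  proof
    show "?S \<subseteq> C" unfolding segment_def using inC by blast
    show "C \<subseteq> ?S"
      unfolding C
    proof (rule component_subset)
      show "x \<in> ?S" using start_in_segment c by metis
      fix y z assume "y \<in> ?S" "adj I J y z"
      then obtain j where "j \<in> {..<c}" and y: "y = (next_vertex ^^ j) x"
        unfolding segment_def by blast
      then have j: "j < c" "y = (next_vertex ^^ j) x" by simp_all
      from \<open>adj I J y z\<close> show "z \<in> ?S"
        unfolding adj_iff
      proof
        assume y: "y \<in> set I \<and> next_vertex y = z"
        then have "z = (next_vertex ^^ Suc j) x" using j by simp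
        then show ?thesis
          using funpow_in_segment[of "Suc j" c next_vertex x] \<open>x \<in> ?S\<close> c j by (cases "Suc j = c") auto
      next
        assume z: "z \<in> set I \<and> next_vertex z = y"
        \<comment> \<open>The predecessor of the start \<open>x\<close> sits at position
          \<open>c - 1\<close>.\<close>
        obtain i where i: "i < c" "y = next_vertex ((next_vertex ^^ i) x)"
        proof (cases j)
          case 0
          then have "y = next_vertex ((next_vertex ^^ (c - 1)) x)"
            using j c by (cases c) simp_all
          then show ?thesis using that[of "c - 1"] c(1) by simp
        next
          case (Suc i)
          then show ?thesis using that[of i] j by simp
        qed
        then have "z = (next_vertex ^^ i) x"
          using z inC[of i] CI next_vertex_inj[of z "(next_vertex ^^ i) x"] by auto
        then show ?thesis using funpow_in_segment i by metis
      qed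
    qed
  qed
  moreover have "card ?S = c"
    using inC CI c_min by (intro card_segment_next_vertex) auto
  ultimately show ?thesis using xC CI inC c by (intro bexI[of _ x]) auto
qed

section \<open>Embeddings of the graph as placements of its components\<close>

lemma components_disjoint:
  "C \<in> components I J \<Longrightarrow> C' \<in> components I J \<Longrightarrow> C \<noteq> C' \<Longrightarrow> C \<inter> C' = {}"
  unfolding components_def using component_eqI by blast

lemma Union_components: "\<Union>(components I J) = vertices"
  unfolding components_def using component_subset_vertices component_self by blast

lemma finite_components: "finite (components I J)"
  by (simp add: components_def)

lemma finite_in_components: "C \<in> components I J \<Longrightarrow> finite C"
  unfolding components_def using finite_component by blast

lemma sum_card_components: "(\<Sum>C\<in>components I J. card C) = card vertices"
  unfolding Union_components[symmetric]
  by (rule card_Union_disjoint[symmetric])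
    (auto simp: pairwise_def disjnt_def components_disjoint finite_in_components)

definition embeddings :: "nat set \<Rightarrow> (nat \<Rightarrow> nat) \<Rightarrow> (nat \<Rightarrow> nat) set" where
  "embeddings X w = {\<phi> \<in> vertices \<rightarrow>\<^sub>E X. inj_on \<phi> vertices \<and>
     (\<forall>l < length I. w (\<phi> (I ! l)) = \<phi> (J ! l))}"

definition cycle_components :: "nat set set" where
  "cycle_components = {C \<in> components I J. is_cycle_comp I J C}"

definition path_components :: "nat set set" where
  "path_components = {C \<in> components I J. \<not> is_cycle_comp I J C}"

lemma components_split: "cycle_components \<union> path_components = components I J"
  "cycle_components \<inter> path_components = {}"
  by (auto simp: cycle_components_def path_components_def)

text \<open>On a path the last vertex is the only one outside \<open>set I\<close>, on a cycle there
  is none, so the two shapes of a traversal match the numerical test \<open>is_cycle_comp\<close>.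
  Base points are chosen for all components at once.\<close>

lemma traversal_exists:
  "\<exists>a. \<forall>C\<in>components I J. a C \<in> C \<and> segment next_vertex (a C) (card C) = C \<and>
    (\<forall>j. Suc j < card C \<longrightarrow> (next_vertex ^^ j) (a C) \<in> set I) \<and>
    (is_cycle_comp I J C \<longrightarrow> (next_vertex ^^ card C) (a C) = a C) \<and>
    (\<not> is_cycle_comp I J C \<longrightarrow>
      (next_vertex ^^ (card C - 1)) (a C) \<notin> set I \<and> card C = Suc (edges_in I J C))"
proof -
  have "\<exists>a. a \<in> C \<and> segment next_vertex a (card C) = C \<and>
    (\<forall>j. Suc j < card C \<longrightarrow> (next_vertex ^^ j) a \<in> set I) \<and>
    (is_cycle_comp I J C \<longrightarrow> (next_vertex ^^ card C) a = a) \<and>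
    (\<not> is_cycle_comp I J C \<longrightarrow> (next_vertex ^^ (card C - 1)) a \<notin> set I \<and> card C = Suc (edges_in I J C))"
    if CK: "C \<in> components I J" for C
  proof -
    obtain x where x: "x \<in> vertices" "C = component I J x" using CK by (auto simp: components_def)
    have fin: "finite C" using CK finite_in_components by blast
    from component_traversal[OF x] obtain a where a: "a \<in> C" "segment next_vertex a (card C) = C"
      "\<forall>j. Suc j < card C \<longrightarrow> (next_vertex ^^ j) a \<in> set I"
      "C \<subseteq> set I \<and> (next_vertex ^^ card C) a = a \<or> C \<inter> set I = C - {(next_vertex ^^ (card C - 1)) a}"
      by blast
    from a(4) show ?thesis
    proof
      assume cyc: "C \<subseteq> set I \<and> (next_vertex ^^ card C) a = a"
      then have "is_cycle_comp I J C" by (simp add: is_cycle_comp_def edges_in_eq Int_absorb2)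
      with a cyc show ?thesis by blast
    next
      assume path: "C \<inter> set I = C - {(next_vertex ^^ (card C - 1)) a}"
      have pos: "0 < card C" using a(1) fin card_gt_0_iff by blast
      have last: "(next_vertex ^^ (card C - 1)) a \<in> C"
        using funpow_in_segment[of "card C - 1" "card C" next_vertex a] pos a(2) by simp
      then have "card C = Suc (edges_in I J C)"
        using path fin pos by (simp add: edges_in_eq)
      moreover from this have "\<not> is_cycle_comp I J C" by (simp add: is_cycle_comp_def)
      ultimately show ?thesis using a(1-3) path last by blast
    qed
  qed
  then show ?thesis by metis
qed

lemma card_path_component: "C \<in> path_components \<Longrightarrow> card C = Suc (edges_in I J C)"
  using traversal_exists unfolding path_components_def by blast

lemma embeddings_step:
  "\<phi> \<in> embeddings X w \<Longrightarrow> x \<in> set I \<Longrightarrow> w (\<phi> x) = \<phi> (next_vertex x)"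
  by (auto simp: embeddings_def in_set_conv_nth next_vertex_nth)

text \<open>An embedding turns a step along \<open>next_vertex\<close> into a step of
  \<open>w\<close>, so it is determined by the images of the base points. The components themselves
  serve as indices of the placement.\<close>

lemma card_embeddings_eq_placements:
  assumes w: "w permutes X"
  shows "card (embeddings X w) = card (placements X w cycle_components path_components card)"
proof -
  let ?K = "components I J" and ?P = "placements X w cycle_components path_components card"
  obtain a where "\<forall>C\<in>?K. a C \<in> C \<and> segment next_vertex (a C) (card C) = C \<and>
    (\<forall>j. Suc j < card C \<longrightarrow> (next_vertex ^^ j) (a C) \<in> set I) \<and>
    (is_cycle_comp I J C \<longrightarrow> (next_vertex ^^ card C) (a C) = a C) \<and>
    (\<not> is_cycle_comp I J C \<longrightarrow>
      (next_vertex ^^ (card C - 1)) (a C) \<notin> set I \<and> card C = Suc (edges_in I J C))"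
    using traversal_exists by blast
  then have a: "\<And>C. C \<in> ?K \<Longrightarrow> a C \<in> C"
    "\<And>C. C \<in> ?K \<Longrightarrow> segment next_vertex (a C) (card C) = C"
    "\<And>C j. C \<in> ?K \<Longrightarrow> Suc j < card C \<Longrightarrow> (next_vertex ^^ j) (a C) \<in> set I"
    "\<And>C. C \<in> cycle_components \<Longrightarrow> (next_vertex ^^ card C) (a C) = a C"
    "\<And>C. C \<in> path_components \<Longrightarrow> (next_vertex ^^ (card C - 1)) (a C) \<notin> set I"
    unfolding cycle_components_def path_components_def by blast+
  define comp where "comp = component I J"
  define pos where "pos v = inv_into {..<card (comp v)} (\<lambda>j. (next_vertex ^^ j) (a (comp v))) v" for v
  have inj: "inj_on (\<lambda>j. (next_vertex ^^ j) (a C)) {..<card C}" if "C \<in> ?K" for C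
    using a(2)[OF that] card_segment_eq_iff by metis
  have comp_in: "comp v \<in> ?K" if "v \<in> vertices" for v
    using that by (simp add: comp_def components_def)
  have pos: "pos v < card (comp v)" "(next_vertex ^^ pos v) (a (comp v)) = v" if v: "v \<in> vertices" for v
  proof -
    have "v \<in> (\<lambda>j. (next_vertex ^^ j) (a (comp v))) ` {..<card (comp v)}"
      using a(2)[OF comp_in[OF v]] component_self[of v] by (simp add: comp_def segment_def)
    from inv_into_into[OF this] f_inv_into_f[OF this]
    show "pos v < card (comp v)" "(next_vertex ^^ pos v) (a (comp v)) = v"
      by (simp_all only: pos_def lessThan_iff)
  qed
  have point: "(next_vertex ^^ j) (a C) \<in> C" "(next_vertex ^^ j) (a C) \<in> vertices"
    "comp ((next_vertex ^^ j) (a C)) = C" "pos ((next_vertex ^^ j) (a C)) = j"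
    if C: "C \<in> ?K" and j: "j < card C" for C j
  proof -
    show inC: "(next_vertex ^^ j) (a C) \<in> C"
      using funpow_in_segment[OF j, of next_vertex "a C"] unfolding a(2)[OF C] .
    then show "(next_vertex ^^ j) (a C) \<in> vertices" using C Union_components by blast
    show comp: "comp ((next_vertex ^^ j) (a C)) = C"
      using inC C component_eqI by (auto simp: comp_def components_def)
    show "pos ((next_vertex ^^ j) (a C)) = j"
      unfolding pos_def comp by (rule inv_into_f_f[OF inj[OF C]]) (use j in simp)
  qed
  have card_pos: "0 < card C" if "C \<in> ?K" for C
    using a(1)[OF that] finite_in_components[OF that] card_gt_0_iff by blast
  define F where "F \<phi> = (\<lambda>C\<in>?K. \<phi> (a C))" for \<phi> :: "nat \<Rightarrow> nat"
  define G where "G s = (\<lambda>v\<in>vertices. (w ^^ pos v) (s (comp v)))" for s :: "nat set \<Rightarrow> nat"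
  \<comment> \<open>Links the two notions of injectivity: the image of all vertices is the union of
    the segments, so the map is injective iff the segments cover as many points as there are
    vertices.\<close>
  have images: "\<phi> ` vertices = (\<Union>C\<in>?K. segment w (s C) (card C))"
    if walk: "\<And>C j. C \<in> ?K \<Longrightarrow> j < card C \<Longrightarrow> \<phi> ((next_vertex ^^ j) (a C)) = (w ^^ j) (s C)" for \<phi> s
  proof -
    have "\<phi> ` C = segment w (s C) (card C)" if "C \<in> ?K" for C
    proof -
      have "\<phi> ` C = \<phi> ` (\<lambda>j. (next_vertex ^^ j) (a C)) ` {..<card C}"
        using a(2)[OF that] by (simp add: segment_def)
      also have "\<dots> = segment w (s C) (card C)"
        unfolding segment_def image_image using walk[OF that] by (intro image_cong) auto
      finally show ?thesis .
    qed
    then show ?thesis unfolding Union_components[symmetric] by blast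
  qed
  have F_walk: "\<phi> ((next_vertex ^^ j) (a C)) = (w ^^ j) (F \<phi> C)"
    if \<phi>: "\<phi> \<in> embeddings X w" and C: "C \<in> ?K" and j: "j < card C" for \<phi> C j
    using j
  proof (induction j)
    case (Suc j)
    then show ?case using a(3)[OF C, of j] embeddings_step[OF \<phi>, of "(next_vertex ^^ j) (a C)"] by simp
  qed (use C in \<open>simp add: F_def\<close>)
  have G_walk: "G s ((next_vertex ^^ j) (a C)) = (w ^^ j) (s C)"
    if "C \<in> ?K" "j < card C" for s C j
    using point[OF that] by (simp add: G_def)
  have "bij_betw F (embeddings X w) ?P"
  proof (rule bij_betw_byWitness[where f' = G])
    show "\<forall>\<phi>\<in>embeddings X w. G (F \<phi>) = \<phi>"
    proof
      fix \<phi> assume \<phi>: "\<phi> \<in> embeddings X w"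
      show "G (F \<phi>) = \<phi>"
      proof
        fix v
        show "G (F \<phi>) v = \<phi> v"
        proof (cases "v \<in> vertices")
          case True
          then show ?thesis
            using F_walk[OF \<phi> comp_in[OF True] pos(1)[OF True]] pos(2)[OF True] by (simp add: G_def)
        next
          case False
          then show ?thesis using \<phi> by (auto simp: G_def embeddings_def PiE_def extensional_def)
        qed
      qed
    qed
    show "\<forall>s\<in>?P. F (G s) = s"
    proof
      fix s assume "s \<in> ?P"
      then have "s \<in> ?K \<rightarrow>\<^sub>E X" by (simp add: placements_def components_split)
      moreover have "G s (a C) = s C" if "C \<in> ?K" for C
        using G_walk[OF that card_pos[OF that]] by simp
      ultimately show "F (G s) = s" by (auto simp: F_def fun_eq_iff PiE_def extensional_def)
    qed
    show "F ` embeddings X w \<subseteq> ?P"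
    proof
      fix s assume "s \<in> F ` embeddings X w"
      then obtain \<phi> where \<phi>: "\<phi> \<in> embeddings X w" and s: "s = F \<phi>" by blast
      have "F \<phi> \<in> ?K \<rightarrow>\<^sub>E X"
        using \<phi> a(1) Union_components by (auto simp: F_def embeddings_def)
      moreover have "(w ^^ card C) (F \<phi> C) = F \<phi> C" if C: "C \<in> cycle_components" for C
      proof -
        have CK: "C \<in> ?K" using C components_split by blast
        obtain c where c: "card C = Suc c" using card_pos[OF CK] gr0_conv_Suc by blast
        have last: "(next_vertex ^^ c) (a C) \<in> C" using point(1)[OF CK] c by simp
        moreover have "C \<inter> set I = C"
          using C finite_in_components[OF CK] edges_in_eq card_subset_eq[of C "C \<inter> set I"]
          by (auto simp: cycle_components_def is_cycle_comp_def)
        ultimately have "w (\<phi> ((next_vertex ^^ c) (a C))) = \<phi> (a C)"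
          using embeddings_step[OF \<phi>, of "(next_vertex ^^ c) (a C)"] a(4)[OF C] c by auto
        then show ?thesis using F_walk[OF \<phi> CK, of c] c CK by (simp add: F_def)
      qed
      moreover have "card (\<Union>C\<in>?K. segment w (F \<phi> C) (card C)) = (\<Sum>C\<in>?K. card C)"
      proof -
        have "\<phi> ` vertices = (\<Union>C\<in>?K. segment w (F \<phi> C) (card C))"
          using F_walk[OF \<phi>] by (rule images)
        moreover have "card (\<phi> ` vertices) = card vertices"
          using \<phi> by (intro card_image) (simp add: embeddings_def)
        ultimately show ?thesis using sum_card_components by metis
      qed
      ultimately show "s \<in> ?P" unfolding s placements_def components_split by blast
    qed
    show "G ` ?P \<subseteq> embeddings X w"
    proof
      fix \<phi> assume "\<phi> \<in> G ` ?P"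
      then obtain s where sP: "s \<in> ?P" and \<phi>: "\<phi> = G s" by blast
      from sP have s: "s \<in> ?K \<rightarrow>\<^sub>E X" "\<And>C. C \<in> cycle_components \<Longrightarrow> (w ^^ card C) (s C) = s C"
        "card (\<Union>C\<in>?K. segment w (s C) (card C)) = (\<Sum>C\<in>?K. card C)"
        by (simp_all add: placements_def components_split)
      have "G s \<in> vertices \<rightarrow>\<^sub>E X"
      proof (rule PiE_I)
        fix v assume v: "v \<in> vertices"
        then have "s (comp v) \<in> X" using s(1) comp_in by blast
        then show "G s v \<in> X" using v permutes_in_image[OF permutes_funpow[OF w]] by (simp add: G_def)
      qed (simp add: G_def)
      moreover have "card (G s ` vertices) = card vertices"
      proof -
        have "G s ` vertices = (\<Union>C\<in>?K. segment w (s C) (card C))"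
          using G_walk by (rule images)
        then show ?thesis using s(3) sum_card_components by metis
      qed
      then have "inj_on (G s) vertices" by (intro eq_card_imp_inj_on) simp_all
      moreover have "w (G s (I ! l)) = G s (J ! l)" if l: "l < length I" for l
      proof -
        have v: "I ! l \<in> vertices" "I ! l \<in> set I" using l by auto
        let ?C = "comp (I ! l)" and ?j = "pos (I ! l)"
        note CK = comp_in[OF v(1)] and p = pos[OF v(1)]
        have Jl: "J ! l = (next_vertex ^^ Suc ?j) (a ?C)" using p(2) next_vertex_nth[OF l] by simp
        have "w (G s (I ! l)) = (w ^^ Suc ?j) (s ?C)" using v by (simp add: G_def)
        also have "\<dots> = G s (J ! l)"
        proof (cases "Suc ?j < card ?C")
          case True
          then show ?thesis using G_walk[OF CK True] Jl by simp
        next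
          \<comment> \<open>The last vertex of a traversal has an outgoing edge only on a cycle,
            where it leads back to the base point.\<close>
          case False
          then have c: "card ?C = Suc ?j" using p(1) by simp
          have "?C \<notin> path_components" using a(5)[of ?C] p(2) v(2) c by auto
          then have cyc: "?C \<in> cycle_components" using CK components_split by blast
          show ?thesis
            using s(2)[OF cyc] a(4)[OF cyc] Jl c G_walk[OF CK card_pos[OF CK], of s] by simp
        qed
        finally show ?thesis .
      qed
      ultimately show "\<phi> \<in> embeddings X w" unfolding \<phi> embeddings_def by blast
    qed
  qed
  then show ?thesis by (rule bij_betw_same_card)
qed

end

section \<open>Conjugacy classes and expectations\<close>

text \<open>The j-th power of the cycle rotates the list by j places and so carries the head to
  entry j.\<close>

lemma orbit_eq_set_cycle_of_list:
  assumes "distinct cs" "x \<in> set cs"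
  shows "orbit (cycle_of_list cs) x = set cs"
proof -
  have perm: "cycle_of_list cs permutes set cs" by (rule cycle_permutes)
  have hd_orbit: "set cs \<subseteq> orbit (cycle_of_list cs) (hd cs)"
  proof
    fix y assume "y \<in> set cs"
    then obtain j where j: "j < length cs" "y = cs ! j" by (metis in_set_conv_nth)
    then have "cs \<noteq> []" by auto
    have "map (cycle_of_list cs ^^ j) cs ! 0 = rotate j cs ! 0"
      using cyclic_rotation[OF assms(1)] by simp
    then have "(cycle_of_list cs ^^ j) (hd cs) = y"
      using j \<open>cs \<noteq> []\<close> by (simp add: nth_rotate hd_conv_nth)
    moreover have "hd cs \<in> orbit (cycle_of_list cs) (hd cs)"
      using perm permutation_permutes permutation_self_in_orbit by (metis List.finite_set)
    ultimately show "y \<in> orbit (cycle_of_list cs) (hd cs)"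
      using funpow_in_orbit by metis
  qed
  have "x \<in> orbit (cycle_of_list cs) (hd cs)" using hd_orbit assms(2) by blast
  then have "orbit (cycle_of_list cs) x = orbit (cycle_of_list cs) (hd cs)"
    using orbit_cyclic_eq3 cyclic_on_orbit[OF perm] by (metis List.finite_set)
  with hd_orbit permutes_orbit_subset[OF perm assms(2)] show ?thesis by blast
qed

text \<open>Needed because the expectation divides by the size of the class. A permutation is built
  part by part, each part c as a cycle on c new points at the end.\<close>

lemma conj_class_nonempty:
  assumes "is_partition lam n"
  shows "conj_class n lam \<noteq> {}"
  using assms
proof (induction lam arbitrary: n)
  case empty
  then have "id \<in> conj_class n {#}"
    by (auto simp: is_partition_def conj_class_def cycle_type_def permutes_id)
  then show ?case by blast
next
  case (add c lam)
  define n' where "n' = sum_mset lam"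
  have c: "0 < c" and n: "n = n' + c" using add.prems by (auto simp: is_partition_def n'_def)
  have "is_partition lam n'" using add.prems by (simp add: is_partition_def n'_def)
  then obtain w where w: "w permutes {1..n'}" "cycle_type n' w = lam"
    using add.IH by (auto simp: conj_class_def)
  define cs where "cs = [Suc n'..<Suc n]"
  have cs: "distinct cs" "set cs = {Suc n'..n}" by (auto simp: cs_def)
  define v where "v = cycle_of_list cs \<circ> w"
  have cyc: "cycle_of_list cs permutes {Suc n'..n}" using cycle_permutes[of cs] cs by simp
  have v_small: "v x = w x" if "x \<in> {1..n'}" for x
    using permutes_not_in[OF cyc, of "w x"] permutes_in_image[OF w(1), of x] that by (simp add: v_def)
  have v_big: "v x = cycle_of_list cs x" if "x \<in> {Suc n'..n}" for x
    using permutes_not_in[OF w(1), of x] that by (simp add: v_def)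
  have "v permutes {1..n}"
    unfolding v_def using w(1) cyc n by (intro permutes_compose) (auto intro: permutes_subset)
  moreover have "cycle_type n v = add_mset c lam"
  proof -
    have small: "orbit v x = orbit w x" if "x \<in> {1..n'}" for x
      using that v_small permutes_in_image[OF w(1)]
      by (intro orbit_cong0[symmetric, of _ "{1..n'}"]) auto
    have big: "orbit v x = {Suc n'..n}" if "x \<in> {Suc n'..n}" for x
    proof -
      have "orbit (cycle_of_list cs) x = orbit v x"
        using that v_big permutes_in_image[OF cyc] by (intro orbit_cong0[of _ "{Suc n'..n}"]) auto
      then show ?thesis using orbit_eq_set_cycle_of_list[OF cs(1)] that cs(2) by simp
    qed
    have "{orbit v x | x. x \<in> {1..n}} = insert {Suc n'..n} {orbit w x | x. x \<in> {1..n'}}"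
    proof -
      have "{1..n} = {1..n'} \<union> {Suc n'..n}" using n by auto
      then have "orbit v ` {1..n} = orbit v ` {1..n'} \<union> orbit v ` {Suc n'..n}" by blast
      also have "orbit v ` {Suc n'..n} = (\<lambda>_. {Suc n'..n}) ` {Suc n'..n}"
        using big by (intro image_cong) auto
      also have "\<dots> = {{Suc n'..n}}" using c n by (subst image_constant_conv) simp
      also have "orbit v ` {1..n'} = orbit w ` {1..n'}" using small by simp
      finally show ?thesis by (simp only: Setcompr_eq_image Un_insert_right Un_empty_right)
    qed
    \<comment> \<open>Orbits are collected in a set, so the new block raises the multiset of sizes
      only if it differs from all old ones.\<close>
    moreover have "{Suc n'..n} \<notin> {orbit w x | x. x \<in> {1..n'}}"
    proof
      assume "{Suc n'..n} \<in> {orbit w x | x. x \<in> {1..n'}}"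
      then obtain x where "x \<in> {1..n'}" "orbit w x = {Suc n'..n}" by auto
      then have "{Suc n'..n} \<subseteq> {1..n'}" using permutes_orbit_subset[OF w(1)] by metis
      then show False using c n by auto
    qed
    ultimately show ?thesis
      using w(2) n by (simp add: cycle_type_def)
  qed
  ultimately show ?case by (auto simp: conj_class_def)
qed

lemma finite_conj_class: "finite (conj_class n lam)"
  by (rule finite_subset[OF _ finite_permutations[of "{1..n}"]]) (auto simp: conj_class_def)

text \<open>Conjugation maps orbits to orbits of the same size and keeps distinct ones
  distinct.\<close>

lemma conj_class_conjugate:
  assumes \<sigma>: "\<sigma> permutes {1..n}" and w: "w \<in> conj_class n lam"
  shows "\<sigma> \<circ> w \<circ> inv \<sigma> \<in> conj_class n lam"
proof -
  have wp: "w permutes {1..n}" and lam: "cycle_type n w = lam" using w by (auto simp: conj_class_def)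
  let ?v = "\<sigma> \<circ> w \<circ> inv \<sigma>"
  have perm: "?v permutes {1..n}"
    using \<sigma> wp by (intro permutes_compose permutes_inv)
  have orb: "orbit ?v (\<sigma> x) = \<sigma> ` orbit w x" for x
  proof (rule orbit_inverse[symmetric])
    show "x \<in> orbit w x"
      using wp permutation_permutes permutation_self_in_orbit by (metis finite_atLeastAtMost)
  qed (simp add: permutes_inverses[OF \<sigma>])
  have "{orbit ?v x | x. x \<in> {1..n}} = orbit ?v ` \<sigma> ` {1..n}"
    by (simp only: Setcompr_eq_image permutes_image[OF \<sigma>])
  also have "\<dots> = image \<sigma> ` {orbit w x | x. x \<in> {1..n}}"
    by (simp only: Setcompr_eq_image image_image orb)
  finally have "cycle_type n ?v = image_mset card (mset_set (image \<sigma> ` {orbit w x | x. x \<in> {1..n}}))"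
    by (simp add: cycle_type_def)
  also have "\<dots> = image_mset card (image_mset (image \<sigma>) (mset_set {orbit w x | x. x \<in> {1..n}}))"
    using permutes_inj[OF \<sigma>] by (subst image_mset_mset_set) (auto intro!: inj_onI simp: inj_image_eq_iff)
  also have "\<dots> = cycle_type n w"
    unfolding cycle_type_def image_mset.compositionality
    using permutes_inj[OF \<sigma>] by (intro image_mset_cong) (auto simp: card_image inj_on_subset)
  finally show ?thesis using perm lam by (simp add: conj_class_def)
qed

section \<open>Injections, double counting and the expectation\<close>

lemma extend_to_permutation:
  assumes "finite N" "V \<subseteq> N" "\<phi> \<in> V \<rightarrow> N" "inj_on \<phi> V"
  obtains \<sigma> where "\<sigma> permutes N" "\<And>x. x \<in> V \<Longrightarrow> \<sigma> x = \<phi> x"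
proof -
  have sub: "\<phi> ` V \<subseteq> N" using assms by auto
  have "card (N - V) = card (N - \<phi> ` V)"
    using assms sub by (simp add: card_Diff_subset card_image finite_subset)
  then obtain h where h: "bij_betw h (N - V) (N - \<phi> ` V)"
    using assms(1) finite_same_card_bij by (metis finite_Diff)
  define \<sigma> where "\<sigma> x = (if x \<in> V then \<phi> x else if x \<in> N then h x else x)" for x
  have "bij_betw \<sigma> (V \<union> (N - V)) (\<phi> ` V \<union> (N - \<phi> ` V))"
  proof (rule bij_betw_combine)
    show "bij_betw \<sigma> V (\<phi> ` V)"
      using assms(4) by (auto simp: \<sigma>_def bij_betw_def inj_on_def)
    show "bij_betw \<sigma> (N - V) (N - \<phi> ` V)"
      using h by (subst bij_betw_cong[of _ _ h]) (auto simp: \<sigma>_def)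
  qed auto
  moreover have "V \<union> (N - V) = N" "\<phi> ` V \<union> (N - \<phi> ` V) = N" using assms(2) sub by auto
  ultimately have "\<sigma> permutes N"
    using assms(2) by (intro bij_imp_permutes) (auto simp: \<sigma>_def)
  then show thesis by (rule that) (simp add: \<sigma>_def)
qed

lemma falling_eq_card_injections:
  assumes "finite V" "card V \<le> n"
  shows "falling n (card V) = real (card {\<phi> \<in> V \<rightarrow>\<^sub>E {1..n}. inj_on \<phi> V})"
proof -
  have "falling n (card V) = (\<Prod>i<card V. real (n - i))"
    unfolding falling_def using assms(2) by (intro prod.cong) (auto simp: of_nat_diff)
  also have "\<dots> = real (card {\<phi> \<in> V \<rightarrow>\<^sub>E {1..n}. inj_on \<phi> V})"
    using card_inj_on_subset_funcset[of V "{1..n}" V] assms(1) by (simp add: atLeast0LessThan)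
  finally show ?thesis .
qed

context partial_permutation
begin

text \<open>Double counting of the pairs of a permutation \<open>w\<close> in the class and an injection \<open>\<phi>\<close> that
  embeds the graph of the partial permutation in that of \<open>w\<close>: conjugating by an extension of
  \<open>\<phi>\<close> shows that all \<open>\<phi>\<close> occur equally often.\<close>
lemma sum_card_embeddings:
  assumes sub: "vertices \<subseteq> {1..n}"
  shows "(\<Sum>w\<in>conj_class n lam. card (embeddings {1..n} w)) =
    card {\<phi> \<in> vertices \<rightarrow>\<^sub>E {1..n}. inj_on \<phi> vertices} * card {w \<in> conj_class n lam. ind_IJ I J w}"
proof -
  let ?K = "conj_class n lam" and ?P = "{\<phi> \<in> vertices \<rightarrow>\<^sub>E {1..n}. inj_on \<phi> vertices}"
  let ?R = "\<lambda>w \<phi>. \<forall>l < length I. w (\<phi> (I ! l)) = \<phi> (J ! l)"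
  have finP: "finite ?P" by (rule finite_subset[of _ "vertices \<rightarrow>\<^sub>E {1..n}"]) (auto intro: finite_PiE)
  have emb: "embeddings {1..n} w = {\<phi> \<in> ?P. ?R w \<phi>}" for w
    by (auto simp: embeddings_def)
  have fibre: "card {w \<in> ?K. ?R w \<phi>} = card {w \<in> ?K. ind_IJ I J w}" if \<phi>: "\<phi> \<in> ?P" for \<phi>
  proof -
    obtain \<sigma> where \<sigma>: "\<sigma> permutes {1..n}" "\<And>x. x \<in> vertices \<Longrightarrow> \<sigma> x = \<phi> x"
      using extend_to_permutation[of "{1..n}" vertices \<phi>] sub \<phi> by (auto simp: PiE_def)
    note inv_\<sigma> = permutes_inverses[OF \<sigma>(1)]
    have \<sigma>': "inv \<sigma> permutes {1..n}" using \<sigma>(1) by (rule permutes_inv)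
    have "bij_betw (\<lambda>w. \<sigma> \<circ> w \<circ> inv \<sigma>) {w \<in> ?K. ind_IJ I J w} {w \<in> ?K. ?R w \<phi>}"
    proof (rule bij_betw_byWitness[where f' = "\<lambda>w. inv \<sigma> \<circ> w \<circ> \<sigma>"])
      show "(\<lambda>w. \<sigma> \<circ> w \<circ> inv \<sigma>) ` {w \<in> ?K. ind_IJ I J w} \<subseteq> {w \<in> ?K. ?R w \<phi>}"
      proof clarify
        fix w assume w: "w \<in> ?K" "ind_IJ I J w"
        have "(\<sigma> \<circ> w \<circ> inv \<sigma>) (\<phi> (I ! l)) = \<phi> (J ! l)" if "l < length I" for l
          using that w(2) length_eq inv_\<sigma> \<sigma>(2)[of "I ! l"] \<sigma>(2)[of "J ! l"]
          by (simp add: ind_IJ_def flip: \<sigma>(2))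
        then show "\<sigma> \<circ> w \<circ> inv \<sigma> \<in> ?K \<and> ?R (\<sigma> \<circ> w \<circ> inv \<sigma>) \<phi>"
          using conj_class_conjugate[OF \<sigma>(1) w(1)] by blast
      qed
      show "(\<lambda>w. inv \<sigma> \<circ> w \<circ> \<sigma>) ` {w \<in> ?K. ?R w \<phi>} \<subseteq> {w \<in> ?K. ind_IJ I J w}"
      proof clarify
        fix w assume w: "w \<in> ?K" "?R w \<phi>"
        have "(inv \<sigma> \<circ> w \<circ> \<sigma>) (I ! l) = J ! l" if l: "l < length I" for l
        proof -
          have "\<sigma> (I ! l) = \<phi> (I ! l)" "\<sigma> (J ! l) = \<phi> (J ! l)" using l length_eq \<sigma>(2) by auto
          then show ?thesis using w(2) l inv_\<sigma> by (metis comp_apply)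
        qed
        then show "inv \<sigma> \<circ> w \<circ> \<sigma> \<in> ?K \<and> ind_IJ I J (inv \<sigma> \<circ> w \<circ> \<sigma>)"
          using conj_class_conjugate[OF \<sigma>' w(1)] \<sigma>(1) by (simp add: ind_IJ_def permutes_inv_inv)
      qed
    qed (simp_all add: fun_eq_iff inv_\<sigma>)
    then show ?thesis by (rule bij_betw_same_card[symmetric])
  qed
  have "(\<Sum>w\<in>?K. card (embeddings {1..n} w)) = (\<Sum>\<phi>\<in>?P. card {w \<in> ?K. ?R w \<phi>})"
    unfolding emb by (rule sum_multicount_gen[OF finite_conj_class finP]) simp
  also have "\<dots> = card ?P * card {w \<in> ?K. ind_IJ I J w}"
    using fibre by simp
  finally show ?thesis .
qed

text \<open>Translates lengths of paths in edges into sizes in vertices.\<close>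

lemma path_partition_vertices:
  "image_mset card (mset_set path_components) = image_mset Suc (path_partition I J)"
proof -
  have "image_mset card (mset_set path_components) =
    image_mset (\<lambda>C. Suc (edges_in I J C)) (mset_set path_components)"
    using finite_components by (intro image_mset_cong) (auto simp: path_components_def card_path_component)
  then show ?thesis
    by (simp add: path_partition_def path_components_def image_mset.compositionality o_def)
qed

lemma cycle_partition_vertices:
  "image_mset card (mset_set cycle_components) = cycle_partition I J"
  unfolding cycle_partition_def cycle_components_def
  using finite_components by (intro image_mset_cong) (auto simp: is_cycle_comp_def)

text \<open>All members of the class have the same cycle type, hence the same number of embeddings;
  the double count is this constant times the class size, which cancels.\<close>

lemma falling_times_expect_ind:
  assumes sub: "vertices \<subseteq> {1..n}" and lam: "is_partition lam n"
    and f: "counts_placements (cycle_partition I J) (image_mset Suc (path_partition I J)) f"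
  shows "falling n (card vertices) * expect_ind n lam I J = ipoly_eval f (type_values n lam)"
proof -
  let ?K = "conj_class n lam" and ?x = "type_values n lam"
  have emb: "real (card (embeddings {1..n} w)) = ipoly_eval f ?x" if "w \<in> ?K" for w
  proof -
    have w: "w permutes {1..n}" "cycle_type n w = lam" using that by (auto simp: conj_class_def)
    have "finite cycle_components" "finite path_components"
      using finite_components by (simp_all add: cycle_components_def path_components_def)
    then show ?thesis
      using f[unfolded counts_placements_def, rule_format, OF w(1) _ _ components_split(2)
          cycle_partition_vertices path_partition_vertices] w
      by (simp add: card_embeddings_eq_placements)
  qed
  have cardK: "0 < card ?K"
    using conj_class_nonempty[OF lam] finite_conj_class card_gt_0_iff by blast
  have "card vertices \<le> n" using card_mono[OF _ sub] by simp
  then have "falling n (card vertices) * real (card {w \<in> ?K. ind_IJ I J w}) =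
    real (\<Sum>w\<in>?K. card (embeddings {1..n} w))"
    using falling_eq_card_injections[of vertices n] sum_card_embeddings[OF sub] by simp
  also have "\<dots> = real (card ?K) * ipoly_eval f ?x" using emb by simp
  finally show ?thesis using cardK by (simp add: expect_ind_def field_simps)
qed

end

theorem theorem1p1:
  fixes \<mu> \<nu> :: "nat multiset" and k :: nat
  assumes "0 \<notin># \<mu>" and "0 \<notin># \<nu>" and "k = sum_mset \<mu> + sum_mset \<nu>"
  shows "\<exists>f :: ipoly. ipoly_vars_le f k \<and> f \<noteq> 0 \<and> ipoly_wdeg f = k \<and>
    (\<forall>n I J lam. n \<ge> 1 \<longrightarrow> partial_perm n I J \<longrightarrow> length I = k \<longrightarrow>
       cycle_partition I J = \<mu> \<longrightarrow> path_partition I J = \<nu> \<longrightarrow> is_partition lam n \<longrightarrow>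
       falling n (card (set I \<union> set J)) * expect_ind n lam I J =
       ipoly_eval f (\<lambda>i. if i = 0 then real n else real (count lam i)))"
proof -
  let ?\<nu> = "image_mset Suc \<nu>"
  obtain f L where f: "placement_poly \<mu> ?\<nu> f L"
    using placement_poly_exists[of \<mu> ?\<nu>] assms(1) by auto
  \<comment> \<open>Every path of \<open>G(I,J)\<close> has an edge, thus at least two vertices, and
    the invariant yields a limit of strict sign.\<close>
  have "1 \<notin># ?\<nu>" using assms(2) by auto
  then have L: "L \<noteq> 0" using f by (auto simp: placement_poly_def)
  have edges: "edge_number \<mu> ?\<nu> = k"
    by (simp add: edge_number_def assms(3) image_mset.compositionality o_def)
  \<comment> \<open>Without isolated vertices the \<open>max 1\<close> has no effect, and the weight
    and edge bounds both equal \<open>k\<close>.\<close>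
  have "image_mset (\<lambda>v. max 1 v) \<nu> = image_mset (\<lambda>v. v) \<nu>"
    using assms(2) by (intro image_mset_cong) (metis One_nat_def Suc_leI gr0I max.absorb2)
  then have "weight_bound \<mu> ?\<nu> = k"
    by (simp add: weight_bound_def assms(3) image_mset.compositionality o_def)
  with f edges have bounded: "ipoly_bounded f k k" and lead: "leading_limit f k L"
    and counts: "counts_placements \<mu> ?\<nu> f"
    by (simp_all add: placement_poly_def)
  have "falling n (card (set I \<union> set J)) * expect_ind n lam I J = ipoly_eval f (type_values n lam)"
    if "partial_perm n I J" "cycle_partition I J = \<mu>" "path_partition I J = \<nu>" "is_partition lam n"
    for n I J lam
  proof -
    interpret partial_permutation I J
      using that(1) by unfold_locales (auto simp: partial_perm_def)
    show ?thesis
      using that counts by (intro falling_times_expect_ind) (auto simp: partial_perm_def)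
  qed
  then show ?thesis
    using bounded ipoly_wdeg_eqI[OF bounded lead L]
    by (intro exI[of _ f]) (auto simp: ipoly_bounded_def type_values_def)
qed

end
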